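(* Let $5\le k\le n$ be integers with $k$ odd, let $d=\frac{k-1}{2}$, let $C=(\mathbb{Z}_n,E)$ be the cycle with $E=\{\{u,u+1\}:u\in\mathbb{Z}_n\}$, and let $v:\mathbb{Z}_k\to\mathbb{Z}_n$ be injective. The half-chorded odd cycle inequality $\sum_{i\in\mathbb{Z}_k}(x_{v_iv_{i+d}}-x_{v_iv_{i+1}})\le k-3$ is facet-defining for $\mathrm{LMC}(C)$ if and only if $v$ is true to $C$.
   Context: $\mathbb{Z}_n$ is the ring of integers modulo $n$; indices of $v$ are taken modulo $k$. For $a,b\in\mathbb{Z}_n$, the interval $[a,b]=\{a,a+1,\dots,b\}$ (going forward from $a$ to $b$ around the cycle), $[a,b[\,=[a,b]\setminus\{b\}$, $]a,b]=[a,b]\setminus\{a\}$. A cyclic sequence $v:\mathbb{Z}_k\to\mathbb{Z}_n$ is true to $C$ if either $v_i\in[v_0,v_{i+1}[$ for all $i=0,\dots,k-2$, or $v_i\in\,]v_{i+1},v_0]$ for all $i=0,\dots,k-2$. A decomposition of $C$ is a partition of $\mathbb{Z}_n$ whose blocks induce connected subgraphs of $C$; its lifted multicut is the set of pairs $ab\in\binom{\mathbb{Z}_n}{2}$ with $a,b$ in distinct blocks. $\mathrm{LMC}(C)\subseteq\mathbb{R}^{\binom{\mathbb{Z}_n}{2}}$ is the convex hull of the characteristic vectors of these lifted multicuts over all decompositions of $C$. *)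

theory Defs
  imports "HOL-Analysis.Analysis" "Berlekamp_Zassenhaus.Finite_Field"
begin

text \<open>
  The ring of integers modulo \<open>n\<close> is the type \<open>'n mod_ring\<close> with \<open>n = CARD('n)\<close>; the class
  \<open>nontriv\<close> says \<open>n > 1\<close>. Cyclic sequences of length \<open>k\<close> are functions on \<open>nat\<close> of which only
  the values on \<open>{..<k}\<close> matter; index arithmetic is done modulo \<open>k\<close>.
\<close>

text \<open>The interval from \<open>a\<close> forward to \<open>b\<close>: the representative of \<open>b - a\<close> in \<open>{0..<n}\<close> is
  the number of steps.\<close>

definition cyc_interval :: "'n::nontriv mod_ring \<Rightarrow> 'n mod_ring \<Rightarrow> 'n mod_ring set" where
  "cyc_interval a b = {a + of_nat j | j. int j \<le> to_int_mod_ring (b - a)}"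

definition true_to_cycle :: "nat \<Rightarrow> (nat \<Rightarrow> 'n::nontriv mod_ring) \<Rightarrow> bool" where
  "true_to_cycle k v \<longleftrightarrow>
     (\<forall>i\<in>{0..k-2}. v i \<in> cyc_interval (v 0) (v (i+1)) - {v (i+1)}) \<or>
     (\<forall>i\<in>{0..k-2}. v i \<in> cyc_interval (v (i+1)) (v 0) - {v (i+1)})"

definition cycle_edges :: "'n::nontriv mod_ring set set" where
  "cycle_edges = {{u, u + 1} | u. True}"

text \<open>A vertex set \<open>U\<close> induces a connected subgraph of the graph with edge set \<open>E\<close>.\<close>

definition induces_connected :: "'v set set \<Rightarrow> 'v set \<Rightarrow> bool" where
  "induces_connected E U \<longleftrightarrow> U \<noteq> {} \<and>
     (\<forall>a\<in>U. \<forall>b\<in>U. (a, b) \<in> {(x, y). x \<in> U \<and> y \<in> U \<and> {x, y} \<in> E}\<^sup>*)"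

definition decompositions :: "'v set set \<Rightarrow> 'v set set set" where
  "decompositions E = {P. partition_on UNIV P \<and> (\<forall>U\<in>P. induces_connected E U)}"

definition lifted_multicut :: "'v set set \<Rightarrow> 'v set set" where
  "lifted_multicut P = {{a, b} | a b. \<exists>A\<in>P. \<exists>B\<in>P. A \<noteq> B \<and> a \<in> A \<and> b \<in> B}"

text \<open>The index type of the coordinates: two-element sets of vertices.\<close>

typedef (overloaded) ('n::nontriv) vpair = "{e :: 'n mod_ring set. card e = 2}"
  morphisms vpair_set Abs_vpair
proof -
  have "card {0, 1 :: 'n mod_ring} = 2" by simp
  then show ?thesis by blast
qed

instance vpair :: (nontriv) finite
proof
  have "finite (range (vpair_set :: 'a vpair \<Rightarrow> 'a mod_ring set))"
    by (rule finite)
  then show "finite (UNIV :: 'a vpair set)"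
    by (rule finite_imageD) (simp add: inj_on_def vpair_set_inject)
qed

text \<open>Meaningful for \<open>a \<noteq> b\<close> only.\<close>

definition vpair :: "'n::nontriv mod_ring \<Rightarrow> 'n mod_ring \<Rightarrow> 'n vpair" where
  "vpair a b = Abs_vpair {a, b}"

lemma vpair_set_vpair: "a \<noteq> b \<Longrightarrow> vpair_set (vpair a b) = {a, b}"
  by (simp add: vpair_def Abs_vpair_inverse)

definition char_vec :: "'n::nontriv mod_ring set set \<Rightarrow> real ^ 'n vpair" where
  "char_vec M = (\<chi> e. if vpair_set e \<in> M then 1 else 0)"

definition LMC :: "'n::nontriv mod_ring set set \<Rightarrow> (real ^ 'n vpair) set" where
  "LMC E = convex hull ((\<lambda>P. char_vec (lifted_multicut P)) ` decompositions E)"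

text \<open>The inequality \<open>f x \<le> b\<close>, for a linear functional \<open>f\<close>, is valid for \<open>S\<close> and the face
  of \<open>S\<close> where it is tight is a facet.\<close>

definition facet_defining :: "('a::euclidean_space \<Rightarrow> real) \<Rightarrow> real \<Rightarrow> 'a set \<Rightarrow> bool" where
  "facet_defining f b S \<longleftrightarrow> (\<forall>x\<in>S. f x \<le> b) \<and> {x\<in>S. f x = b} facet_of S"

end

theory Submission
  imports Defs
begin

text \<open>
  Call \<open>i\<close> a cut of a partition if \<open>v i\<close> and \<open>v (i + 1)\<close> lie in distinct blocks. The cuts account for
  the negative terms, each chord contributes at most 1, and a partition with fewer than three cuts joins
  the ends of some chord: hence the inequality is valid, and tight partitions have at most three cuts.

  If \<open>v\<close> is not true to the cycle, the closed polygon \<open>v\<close> drawn on the circle has two crossing edges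
  \<open>a a'\<close> and \<open>b b'\<close>. Having at most three cuts, every tight decomposition then satisfies
  \<open>x_{aa'} + x_{bb'} = x_{ab} + x_{a'b'}\<close>. The origin is a vertex off the hyperplane of the
  inequality, so if the face were a facet this homogeneous equation would hold on the whole polytope,
  which it does not.

  If \<open>v\<close> is true to the cycle, let \<open>c\<close> be orthogonal to all tight vertices. Comparing two tight
  decompositions that differ only in the block of a single vertex \<open>u\<close> equates two sums of coefficients
  \<open>c_{ut}\<close>. Three families of such comparisons force \<open>c\<close> to be a multiple of the inequality, hence
  zero, so the tight vertices span the whole space.
\<close>

text \<open>The length d of the chords is the largest for which three runs are forced. As k = 2 * d
  + 1, a run of d consecutive indices contains no chord and a run of d + 1 contains exactly one. So
  three runs of at most d indices reach k - 3 (all chords cut, three cuts), and so do two runs of d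
  and d + 1; the sufficiency proof uses only these. The comparisons split off a vertex outside
  \<open>v\<close>, split off the first index of a run of d + 1, or hand an index over to the
  neighbouring run. Where an arc length is left free, subtracting two members of the family isolates
  one coefficient.

  In the crossing equation the pairs ab and a'b' are the right ones because the rest of the polygon
  consists of a path from a' to b and one from b' to a. If a decomposition separated aa', bb', a'b
  and b'a, it would have four cuts.

  Arcs and runs may wrap around. The cycle is therefore read on a window of n consecutive integers
  whose start is free, and a true sequence is lifted to an increasing map on the integers.\<close>

section \<open>Facets of convex hulls containing the origin\<close>

text \<open>The face lies in f = b with b nonzero, so the origin is outside its affine hull and
  adjoining it raises the dimension to that of the polytope. A homogeneous equation on the face also
  holds at 0, hence on the common affine hull.\<close>

lemma facet_of_convex_hull_equation_extends:
  fixes f g :: "'a::euclidean_space \<Rightarrow> real"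
  assumes X: "finite X" "0 \<in> X" and lin: "linear f" "linear g" and b: "b \<noteq> 0"
    and facet: "{x \<in> convex hull X. f x = b} facet_of convex hull X"
    and tight: "\<And>x. x \<in> X \<Longrightarrow> f x = b \<Longrightarrow> g x = 0"
    and x: "x \<in> X"
  shows "g x = 0"
proof -
  let ?S = "convex hull X" and ?F = "{x \<in> convex hull X. f x = b}"
  have g_sub: "affine hull T \<subseteq> {x. g x = 0}" if "T \<subseteq> {x. g x = 0}" for T
    using that subspace_imp_affine[OF linear_subspace_kernel[OF lin(2)]] by (rule hull_minimal)
  have "affine {x. f x = b}"
    using lin(1) by (auto simp: affine_def linear_add linear_cmul simp flip: distrib_right)
  then have "affine hull ?F \<subseteq> {x. f x = b}"
    by (intro hull_minimal) auto
  then have not0: "0 \<notin> affine hull ?F"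
    using b linear_0[OF lin(1)] by auto
  \<comment> \<open>The hypothesis on \<open>g\<close> concerns generators only; a face of the hull
    is again the hull of some of them.\<close>
  have "?F face_of ?S" using facet by (rule facet_of_imp_face_of)
  then obtain S' where S': "S' \<subseteq> X" "?F = convex hull S'"
    using face_of_convex_hull_subset[of X ?F] finite_imp_compact[OF X(1)] by blast
  have "S' \<subseteq> ?F" unfolding S'(2) by (rule hull_subset)
  then have "S' \<subseteq> {x. g x = 0}" using tight S'(1) by auto
  then have F0: "insert 0 ?F \<subseteq> {x. g x = 0}"
    using g_sub[of S'] convex_hull_subset_affine_hull[of S'] S'(2) linear_0[OF lin(2)] by auto
  have "insert 0 ?F \<subseteq> ?S" using hull_subset[of X convex] X(2) by auto
  moreover have "aff_dim (insert 0 ?F) = aff_dim ?S"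
    using facet not0 by (simp add: aff_dim_insert facet_of_def)
  ultimately have "affine hull (insert 0 ?F) = affine hull ?S"
    using aff_dim_eq_full_gen by blast
  moreover have "x \<in> affine hull ?S"
    using x by (meson hull_inc)
  ultimately show ?thesis using g_sub[OF F0] by blast
qed

text \<open>If only 0 is orthogonal to all tight points, they span the space. Since f = b misses the
  origin, the affine dimension of a spanning face is one less than that of the space.\<close>

lemma facet_of_convex_hullI:
  fixes f :: "'a::euclidean_space \<Rightarrow> real"
  assumes "0 \<in> X" and lin: "linear f" and b: "b \<noteq> 0"
    and valid: "\<And>x. x \<in> X \<Longrightarrow> f x \<le> b"
    and tight: "\<And>c. (\<And>x. x \<in> X \<Longrightarrow> f x = b \<Longrightarrow> c \<bullet> x = 0) \<Longrightarrow> c = 0"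
  shows "facet_defining f b (convex hull X)"
proof -
  let ?S = "convex hull X" and ?F = "{x \<in> convex hull X. f x = b}"
  define a where "a = adjoint f 1"
  have fa: "f x = a \<bullet> x" for x
    using adjoint_works[OF lin, of x 1] by (simp add: a_def inner_commute)
  have XS: "X \<subseteq> ?S" by (rule hull_subset)
  have "?S \<subseteq> {x. a \<bullet> x \<le> b}"
    using valid by (intro hull_minimal convex_halfspace_le) (auto simp: fa)
  then have le: "\<And>x. x \<in> ?S \<Longrightarrow> a \<bullet> x \<le> b" by blast
  have Feq: "?F = ?S \<inter> {x. a \<bullet> x = b}" by (auto simp: fa)
  have "?F face_of ?S"
    unfolding Feq using convex_convex_hull le by (rule face_of_Int_supporting_hyperplane_le)
  moreover have "span ?F = UNIV"
  proof (rule ccontr)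
    assume "span ?F \<noteq> UNIV"
    then have "dim ?F < DIM('a)"
      using dim_eq_full[of ?F] dim_subset_UNIV[of ?F] by linarith
    from orthogonal_to_subspace_exists[OF this] obtain c
      where c: "c \<noteq> 0" "\<And>y. y \<in> span ?F \<Longrightarrow> orthogonal c y" by metis
    have "c = 0"
      using c(2) XS by (intro tight) (auto simp: orthogonal_def span_base)
    with c(1) show False by simp
  qed
  then have dimF: "dim ?F = DIM('a)" by (metis dim_span dim_UNIV)
  moreover have "?F \<noteq> {}"
  proof
    assume "?F = {}"
    then have "dim ?F = 0" by (simp only: dim_empty)
    with dimF show False by (simp del: dim_eq_0)
  qed
  moreover have "aff_dim ?F = aff_dim ?S - 1"
  proof -
    have "affine hull ?F \<subseteq> {x. a \<bullet> x = b}"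
      by (intro hull_minimal affine_hyperplane) (auto simp: fa)
    then have "0 \<notin> affine hull ?F" using b by auto
    then have "aff_dim (insert 0 ?F) = aff_dim ?F + 1" by (simp add: aff_dim_insert)
    moreover have "aff_dim (insert 0 ?F) = DIM('a)"
      using dimF by (subst aff_dim_zero) (auto simp: hull_inc dim_insert span_zero)
    moreover have "aff_dim (insert 0 ?F) \<le> aff_dim ?S"
      using XS assms(1) by (intro aff_dim_subset) auto
    moreover have "aff_dim ?S \<le> DIM('a)" by (rule aff_dim_le_DIM)
    ultimately show ?thesis by linarith
  qed
  ultimately show ?thesis
    using le by (auto simp: facet_defining_def facet_of_def fa)
qed

section \<open>Decompositions of a cycle\<close>

lemma vpair_commute: "vpair a b = vpair b a"
  by (simp add: vpair_def insert_commute)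

lemma vpair_eq_iff:
  "a \<noteq> b \<Longrightarrow> a' \<noteq> b' \<Longrightarrow> vpair a b = vpair a' b' \<longleftrightarrow> a = a' \<and> b = b' \<or> a = b' \<and> b = a'"
  by (simp add: vpair_set_inject[symmetric] vpair_set_vpair doubleton_eq_iff)

lemma vpair_cases:
  obtains a b where "a \<noteq> b" "e = vpair a b"
proof -
  have "card (vpair_set e) = 2" using vpair_set[of e] by simp
  then obtain a b where "vpair_set e = {a, b}" "a \<noteq> b" by (meson card_2_iff)
  then show ?thesis using that by (metis vpair_def vpair_set_inverse)
qed

definition same_block :: "'v set set \<Rightarrow> 'v \<Rightarrow> 'v \<Rightarrow> bool" where
  "same_block P a b \<longleftrightarrow> (\<exists>U\<in>P. a \<in> U \<and> b \<in> U)"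

lemma same_block_sym: "same_block P a b \<Longrightarrow> same_block P b a"
  by (auto simp: same_block_def)

lemma same_block_refl: "partition_on UNIV P \<Longrightarrow> same_block P a a"
  by (auto simp: same_block_def partition_on_def)

lemma same_block_trans:
  assumes "partition_on UNIV P" "same_block P a b" "same_block P b c"
  shows "same_block P a c"
proof -
  obtain U V where U: "U \<in> P" "a \<in> U" "b \<in> U" and V: "V \<in> P" "b \<in> V" "c \<in> V"
    using assms by (auto simp: same_block_def)
  then have "U = V" using partition_onD2[OF assms(1)] unfolding disjoint_def by (metis disjoint_iff)
  then show ?thesis using U V by (auto simp: same_block_def)
qed

lemma char_vec_lifted_multicut:
  assumes P: "partition_on UNIV P" and ab: "a \<noteq> b"
  shows "char_vec (lifted_multicut P) $ vpair a b = (if same_block P a b then 0 else 1)"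
proof -
  have "{a, b} \<in> lifted_multicut P \<longleftrightarrow> \<not> same_block P a b"
  proof
    assume "{a, b} \<in> lifted_multicut P"
    then obtain a' b' A B where *: "{a, b} = {a', b'}" "A \<in> P" "B \<in> P" "A \<noteq> B" "a' \<in> A" "b' \<in> B"
      by (auto simp: lifted_multicut_def)
    have "\<not> same_block P a' b'"
    proof
      assume "same_block P a' b'"
      then obtain U where U: "U \<in> P" "a' \<in> U" "b' \<in> U" by (auto simp: same_block_def)
      have "U = A" "U = B"
        using * U partition_onD2[OF P] unfolding disjoint_def by (metis disjoint_iff)+
      then show False using \<open>A \<noteq> B\<close> by simp
    qed
    then show "\<not> same_block P a b" using *(1) same_block_sym[of P] by (auto simp: doubleton_eq_iff)
  next
    assume "\<not> same_block P a b"
    moreover obtain A B where AB: "A \<in> P" "a \<in> A" "B \<in> P" "b \<in> B"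
      using partition_onD1[OF P] by (metis UNIV_I UnionE)
    ultimately have "A \<noteq> B" by (auto simp: same_block_def)
    with AB show "{a, b} \<in> lifted_multicut P"
      unfolding lifted_multicut_def by (intro CollectI exI[of _ a] exI[of _ b]) auto
  qed
  then show ?thesis using ab by (simp add: char_vec_def vpair_set_vpair)
qed

section \<open>Arcs of the cycle read on the integers\<close>

lemma of_int_mod_ring_eq_iff:
  "(of_int a :: 'n::nontriv mod_ring) = of_int b \<longleftrightarrow> int CARD('n) dvd a - b"
  unfolding of_int_of_int_mod_ring by transfer (simp add: mod_eq_dvd_iff)

lemma of_int_to_int_mod_ring: "of_int (to_int_mod_ring a) = (a :: 'n::nontriv mod_ring)"
  by (simp add: of_int_of_int_mod_ring)

lemma to_int_mod_ring_bounds: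
  "0 \<le> to_int_mod_ring (a :: 'n::nontriv mod_ring)" "to_int_mod_ring (a :: 'n mod_ring) < int CARD('n)"
  using range_to_int_mod_ring[where 'a='n] by (metis rangeI atLeastLessThan_iff)+

lemma bij_betw_window:
  fixes p \<sigma> :: int
  assumes "\<sigma> = 1 \<or> \<sigma> = -1"
  shows "bij_betw (\<lambda>t. of_int (\<sigma> * t) :: 'n::nontriv mod_ring) {p..<p + int CARD('n)} UNIV"
proof -
  let ?n = "int CARD('n)" and ?\<phi> = "\<lambda>t. of_int (\<sigma> * t) :: 'n mod_ring"
  have "inj_on ?\<phi> {p..<p + ?n}"
  proof (rule inj_onI)
    fix s t assume st: "s \<in> {p..<p + ?n}" "t \<in> {p..<p + ?n}" "?\<phi> s = ?\<phi> t"
    then have "?n dvd s - t"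
      using assms dvd_diff_commute[of ?n s t] unfolding of_int_mod_ring_eq_iff by auto
    then have "s mod ?n = t mod ?n" by (simp add: mod_eq_dvd_iff)
    then show "s = t" using st
      by (smt (verit) atLeastLessThan_iff \<open>?n dvd s - t\<close> zdvd_not_zless dvd_diff_commute)
  qed
  moreover from this have "card (?\<phi> ` {p..<p + ?n}) = CARD('n mod_ring)"
    by (simp add: card_image)
  then have "?\<phi> ` {p..<p + ?n} = UNIV"
    by (intro card_subset_eq) simp_all
  ultimately show ?thesis by (simp add: bij_betw_def)
qed

text \<open>Fibres that are intervals of the window become arcs of the cycle. The sign \<sigma> lets
  one statement serve both orientations.\<close>

lemma decomposition_of_convex_labelling:
  fixes h :: "int \<Rightarrow> int" and p \<sigma> :: int
  defines "I \<equiv> {p..<p + int CARD('n::nontriv)}"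
    and "\<phi> \<equiv> (\<lambda>t. of_int (\<sigma> * t) :: 'n mod_ring)"
  assumes \<sigma>: "\<sigma> = 1 \<or> \<sigma> = -1"
    and conv: "\<And>s t u. s \<in> I \<Longrightarrow> t \<in> I \<Longrightarrow> s < u \<Longrightarrow> u < t \<Longrightarrow> h s = h t \<Longrightarrow> h u = h s"
  shows "\<exists>P \<in> decompositions (cycle_edges :: 'n mod_ring set set).
    \<forall>s\<in>I. \<forall>t\<in>I. same_block P (\<phi> s) (\<phi> t) \<longleftrightarrow> h s = h t"
proof -
  define cls where "cls y = \<phi> ` {t \<in> I. h t = y}" for y
  define P where "P = cls ` h ` I"
  have bij: "bij_betw \<phi> I UNIV"
    unfolding \<phi>_def I_def using \<sigma> by (rule bij_betw_window)
  then have inj: "inj_on \<phi> I" and surj: "\<phi> ` I = UNIV" by (auto simp: bij_betw_def)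
  have mem: "\<phi> t \<in> cls y \<longleftrightarrow> h t = y" if "t \<in> I" for t y
    using that inj by (auto simp: cls_def inj_on_def)
  have "partition_on UNIV P"
  proof (rule partition_onI)
    have "\<phi> t \<in> \<Union> P" if "t \<in> I" for t using that mem by (auto simp: P_def)
    then show "\<Union> P = UNIV" using surj by (metis UNIV_eq_I imageE UNIV_I)
  next
    fix A B assume "A \<in> P" "B \<in> P" "A \<noteq> B"
    then obtain y z where "A = cls y" "B = cls z" "y \<noteq> z"
      unfolding P_def by (metis imageE)
    then show "disjnt A B" by (auto simp: disjnt_iff cls_def dest: inj_onD[OF inj])
  next
    show "{} \<notin> P" by (auto simp: P_def cls_def)
  qed
  moreover have "induces_connected cycle_edges U" if U: "U \<in> P" for U
  proof -
    obtain y where y: "y \<in> h ` I" "U = cls y" using U by (auto simp: P_def)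
    define R where "R = {(a, b). a \<in> U \<and> b \<in> U \<and> {a, b} \<in> (cycle_edges :: 'n mod_ring set set)}"
    have edge: "{\<phi> t, \<phi> (t + 1)} \<in> cycle_edges" for t
      using \<sigma>
    proof
      assume "\<sigma> = 1"
      then have "{\<phi> t, \<phi> (t + 1)} = {\<phi> t, \<phi> t + 1}" by (simp add: \<phi>_def)
      then show ?thesis unfolding cycle_edges_def by blast
    next
      assume "\<sigma> = -1"
      then have "{\<phi> t, \<phi> (t + 1)} = {\<phi> (t + 1), \<phi> (t + 1) + 1}" by (auto simp: \<phi>_def)
      then show ?thesis unfolding cycle_edges_def by blast
    qed
    have "sym R" by (auto simp: R_def sym_def insert_commute)
    then have sym: "(a, b) \<in> R\<^sup>* \<Longrightarrow> (b, a) \<in> R\<^sup>*" for a b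
      by (meson sym_rtrancl symD)
    have reach: "(\<phi> s, \<phi> t) \<in> R\<^sup>*"
      if s: "s \<in> I" "h s = y" and "s \<le> t" and t: "t \<in> I" "h t = y" for s t
    proof -
      have "r \<le> t \<longrightarrow> (\<phi> s, \<phi> r) \<in> R\<^sup>*" if "s \<le> r" for r
        using that
      proof (induction r rule: int_ge_induct)
        case base then show ?case by simp
      next
        case (step r)
        have "h q = y \<and> q \<in> I" if "s \<le> q" "q \<le> t" for q
          using conv[of s t q] s t that by (cases "q = s \<or> q = t") (auto simp: I_def)
        then have "r + 1 \<le> t \<Longrightarrow> (\<phi> r, \<phi> (r + 1)) \<in> R"
          using step.hyps edge[of r] by (simp add: R_def y mem)
        then show ?case using step.IH by (auto intro: rtrancl_into_rtrancl)
      qed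
      then show ?thesis using that by blast
    qed
    have "(a, b) \<in> R\<^sup>*" if ab: "a \<in> U" "b \<in> U" for a b
    proof -
      obtain s t where st: "a = \<phi> s" "s \<in> I" "h s = y" "b = \<phi> t" "t \<in> I" "h t = y"
        using ab by (auto simp: y cls_def)
      show ?thesis using reach[of s t] reach[of t s] sym st by (cases "s \<le> t") auto
    qed
    moreover have "U \<noteq> {}" using y by (auto simp: cls_def)
    ultimately show ?thesis by (auto simp: induces_connected_def R_def)
  qed
  ultimately have "P \<in> decompositions cycle_edges" by (simp add: decompositions_def)
  moreover have "same_block P (\<phi> s) (\<phi> t) \<longleftrightarrow> h s = h t" if "s \<in> I" "t \<in> I" for s t
    using that by (auto simp: same_block_def P_def mem)
  ultimately show ?thesis by auto
qed

text \<open>A connected block leaves an arc only through its ends. If it contained neither u nor w,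
  every path in it from s would stay strictly between w - n and u and could not reach t.\<close>

lemma same_block_arc:
  fixes P :: "'n::nontriv mod_ring set set"
  assumes P: "P \<in> decompositions cycle_edges"
    and same: "same_block P (of_int s) (of_int t)"
    and order: "s < u" "u < t" "t < w" "w < s + int CARD('n)"
  shows "same_block P (of_int s) (of_int u) \<or> same_block P (of_int s) (of_int w)"
proof (rule ccontr)
  let ?n = "int CARD('n)"
  assume no: "\<not> ?thesis"
  obtain U where U: "U \<in> P" "of_int s \<in> U" "of_int t \<in> U"
    using same by (auto simp: same_block_def)
  then have uw: "of_int u \<notin> U" "of_int w \<notin> U" using no by (auto simp: same_block_def)
  define R where "R = {(a, b). a \<in> U \<and> b \<in> U \<and> {a, b} \<in> (cycle_edges :: 'n mod_ring set set)}"
  have "induces_connected cycle_edges U" using P U(1) by (auto simp: decompositions_def)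
  then have "(of_int s, of_int t) \<in> R\<^sup>*" using U by (auto simp: induces_connected_def R_def)
  then have "\<exists>r. w - ?n < r \<and> r < u \<and> (of_int t :: 'n mod_ring) = of_int r"
  proof (induction rule: rtrancl_induct)
    case base then show ?case using order by (intro exI[of _ s]) auto
  next
    case (step y z)
    then obtain r where r: "w - ?n < r" "r < u" "y = of_int r" by blast
    have "z \<in> U" "{y, z} \<in> cycle_edges" using step.hyps(2) by (auto simp: R_def)
    then have "z = y + 1 \<or> y = z + 1" by (auto simp: cycle_edges_def doubleton_eq_iff)
    then have "z = of_int (r + 1) \<or> z = of_int (r - 1)" using r by (auto simp: algebra_simps)
    then show ?case
    proof
      assume z: "z = of_int (r + 1)"
      then have "r + 1 \<noteq> u" using uw \<open>z \<in> U\<close> by auto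
      then show ?thesis using r z by (intro exI[of _ "r + 1"]) auto
    next
      assume z: "z = of_int (r - 1)"
      have "(of_int (w - ?n) :: 'n mod_ring) = of_int w" by (subst of_int_mod_ring_eq_iff) simp
      then have "r - 1 \<noteq> w - ?n" using uw \<open>z \<in> U\<close> z by metis
      then show ?thesis using r z by (intro exI[of _ "r - 1"]) auto
    qed
  qed
  then obtain r where r: "w - ?n < r" "r < u" "?n dvd t - r"
    by (auto simp: of_int_mod_ring_eq_iff)
  \<comment> \<open>From r < u < t the difference t - r is positive, so divisibility makes it at
    least n; but r > w - n and w > t make it less than n.\<close>
  then have "?n \<le> t - r" using order by (intro zdvd_imp_le) auto
  then show False using r order by linarith
qed

section \<open>Partitions of a cyclic sequence\<close>

lemma periodic_add_mult:
  fixes f :: "int \<Rightarrow> 'b"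
  assumes "\<And>i. f (i + k) = f i"
  shows "f (i + k * q) = f i"
proof (induction q rule: int_induct[where k = 0])
  case base then show ?case by simp
next
  case (step1 q)
  then show ?case using assms[of "i + k * q"] by (simp add: algebra_simps)
next
  case (step2 q)
  then show ?case using assms[of "i + k * (q - 1)"] by (simp add: algebra_simps)
qed

lemma periodic_mod:
  fixes f :: "int \<Rightarrow> 'b"
  assumes "\<And>i. f (i + k) = f i"
  shows "f (i mod k) = f i"
  using periodic_add_mult[of f k "i mod k" "i div k", OF assms] by simp

lemma sum_periodic_window:
  fixes f :: "int \<Rightarrow> real"
  assumes per: "\<And>i. f (i + k) = f i" and k: "0 < k"
  shows "(\<Sum>i\<in>{s..<s + k}. f i) = (\<Sum>i\<in>{0..<k}. f i)"
proof -
  have inj: "inj_on (\<lambda>i. i mod k) {s..<s + k}"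
  proof (rule inj_onI)
    fix i j assume ij: "i \<in> {s..<s + k}" "j \<in> {s..<s + k}" "i mod k = j mod k"
    then have "k dvd i - j" by (simp add: mod_eq_dvd_iff)
    moreover have "\<bar>i - j\<bar> < k" using ij by auto
    ultimately show "i = j" by (metis dvd_imp_le_int abs_of_pos k linorder_not_le right_minus_eq)
  qed
  moreover have "(\<lambda>i. i mod k) ` {s..<s + k} = {0..<k}"
  proof (rule card_subset_eq)
    show "card ((\<lambda>i. i mod k) ` {s..<s + k}) = card {0..<k}"
      using inj by (simp add: card_image)
  qed (use k in auto)
  ultimately have "bij_betw (\<lambda>i. i mod k) {s..<s + k} {0..<k}" by (simp add: bij_betw_def)
  from sum.reindex_bij_betw[OF this, of f]
  show ?thesis using periodic_mod[of f k, OF per] by simp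
qed

lemma sum_periodic_reflect:
  fixes f :: "int \<Rightarrow> real"
  assumes per: "\<And>i. f (i + k) = f i" and k: "0 < k"
  shows "(\<Sum>i\<in>{0..<k}. f (c - i)) = (\<Sum>i\<in>{0..<k}. f i)"
proof -
  have "(\<Sum>i\<in>{0..<k}. f (c - i)) = (\<Sum>i\<in>{c - k + 1..<c - k + 1 + k}. f i)"
    by (rule sum.reindex_bij_witness[of _ "\<lambda>i. c - i" "\<lambda>i. c - i"]) auto
  also have "\<dots> = (\<Sum>i\<in>{0..<k}. f i)" by (rule sum_periodic_window[of f k, OF per k])
  finally show ?thesis .
qed

text \<open>\<open>B\<close> is an arbitrary word of block names, so the counting below is about
  periodic words and independent of the graph.\<close>

definition cut :: "(int \<Rightarrow> 'b) \<Rightarrow> int \<Rightarrow> int \<Rightarrow> real" where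
  "cut B i j = (if B i = B j then 0 else 1)"

text \<open>A discrete intermediate value principle, applied to block names and also to truth values
  such as \<open>g i < p\<close>.\<close>

lemma cut_between:
  fixes B :: "int \<Rightarrow> 'b"
  assumes "i \<le> j" "B i \<noteq> B j"
  obtains t where "i \<le> t" "t < j" "B t \<noteq> B (t + 1)"
proof -
  have "(\<forall>t. i \<le> t \<and> t < j \<longrightarrow> B t = B (t + 1)) \<longrightarrow> B i = B j"
    using assms(1) by (induction j rule: int_ge_induct) auto
  then show ?thesis using assms(2) that by blast
qed

context
  fixes B :: "int \<Rightarrow> 'b" and k :: int
  assumes per: "\<And>i. B (i + k) = B i" and k: "0 < k"
begin

lemma cut_window: "(\<Sum>i\<in>{s..<s + k}. cut B i (i + j)) = (\<Sum>i\<in>{0..<k}. cut B i (i + j))"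
  using per[of "i + j" for i] per k
  by (intro sum_periodic_window) (auto simp: cut_def algebra_simps)

lemma card_le_sum_cut:
  assumes "T \<subseteq> {s..<s + k}" "\<And>t. t \<in> T \<Longrightarrow> B t \<noteq> B (t + 1)"
  shows "real (card T) \<le> (\<Sum>i\<in>{0..<k}. cut B i (i + 1))"
proof -
  have "real (card T) = (\<Sum>i\<in>T. cut B i (i + 1))" using assms(2) by (simp add: cut_def)
  also have "\<dots> \<le> (\<Sum>i\<in>{s..<s + k}. cut B i (i + 1))"
    using assms(1) by (intro sum_mono2) (auto simp: cut_def)
  finally show ?thesis unfolding cut_window .
qed

lemma sum_cut_le: "(\<Sum>i\<in>{0..<k}. cut B i (i + j)) \<le> real_of_int k"
proof -
  have "(\<Sum>i\<in>{0..<k}. cut B i (i + j)) \<le> (\<Sum>i\<in>{0..<k}. 1)"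
    by (intro sum_mono) (auto simp: cut_def)
  then show ?thesis using k by simp
qed

lemma half_chorded_valid:
  assumes kd: "k = 2 * d + 1" "1 \<le> d"
  shows "(\<Sum>i\<in>{0..<k}. cut B i (i + d) - cut B i (i + 1)) \<le> k - 3"
proof (cases "\<exists>i. B i \<noteq> B (i + 1)")
  case False
  then have const: "B i = B j" for i j
  proof -
    have "B i = B j" if "i \<le> j" for i j
      using False cut_between[OF that] by metis
    then show ?thesis by (metis linear)
  qed
  have "cut B i j = 0" for i j unfolding cut_def using const[of i j] by simp
  then show ?thesis using kd by simp
next
  case True
  then obtain t1 where t1: "B t1 \<noteq> B (t1 + 1)" by blast
  show ?thesis
  proof (cases "\<exists>i\<in>{0..<k}. B i = B (i + d)")
    case True
    then obtain i where i: "i \<in> {0..<k}" "B i = B (i + d)" by blast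
    have "(\<Sum>i\<in>{0..<k}. cut B i (i + d)) = (\<Sum>i\<in>{0..<k} - {i}. cut B i (i + d))"
      using i by (intro sum.mono_neutral_right) (auto simp: cut_def)
    also have "\<dots> \<le> (\<Sum>i\<in>{0..<k} - {i}. 1)"
      by (intro sum_mono) (auto simp: cut_def)
    also have "\<dots> = k - 1" using i k by (simp add: Suc_le_eq)
    finally have *: "(\<Sum>i\<in>{0..<k}. cut B i (i + d)) \<le> k - 1" .
    \<comment> \<open>After a cut at \<open>t1\<close> the word has to return to \<open>B t1\<close>
      by \<open>t1 + k\<close>, which takes a second cut.\<close>
    obtain t2 where "t1 + 1 \<le> t2" "t2 < t1 + k" "B t2 \<noteq> B (t2 + 1)"
      using cut_between[of "t1 + 1" "t1 + k" B] per[of t1] t1 k by (metis add_le_cancel_left int_one_le_iff_zero_less)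
    then have "real (card {t1, t2}) \<le> (\<Sum>i\<in>{0..<k}. cut B i (i + 1))"
      using t1 by (intro card_le_sum_cut[of _ t1]) auto
    moreover have "card {t1, t2} = 2" using \<open>t1 + 1 \<le> t2\<close> by simp
    ultimately show ?thesis using * by (simp add: sum_subtractf)
  next
    case False
    have chord: "B i \<noteq> B (i + d)" for i
    proof -
      have "B (i mod k) \<noteq> B (i mod k + d)" using False k by auto
      moreover have "B (i mod k + d) = B (i + d)"
        using periodic_add_mult[of B k "i mod k + d" "i div k", OF per] by (simp add: algebra_simps)
      ultimately show ?thesis using periodic_mod[of B k i, OF per] by simp
    qed
    \<comment> \<open>Every chord is cut, so any d consecutive steps contain a cut. This gives t2
      \<le> t1 + d and t3 \<le> t1 + 2 * d < t1 + k: three cuts in one period.\<close>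
    obtain t2 where t2: "t1 + 1 \<le> t2" "t2 < t1 + 1 + d" "B t2 \<noteq> B (t2 + 1)"
      using cut_between[OF _ chord[of "t1 + 1"]] kd by auto
    obtain t3 where t3: "t2 + 1 \<le> t3" "t3 < t2 + 1 + d" "B t3 \<noteq> B (t3 + 1)"
      using cut_between[OF _ chord[of "t2 + 1"]] kd by auto
    have "real (card {t1, t2, t3}) \<le> (\<Sum>i\<in>{0..<k}. cut B i (i + 1))"
      using t1 t2 t3 kd by (intro card_le_sum_cut[of _ t1]) auto
    moreover have "card {t1, t2, t3} = 3" using t2 t3 by simp
    ultimately show ?thesis using sum_cut_le[of d] by (simp add: sum_subtractf)
  qed
qed

text \<open>If all four joins failed, i, j and one index on each of the two stretches between them
  would be four cuts in one period. The chord sum is at most k, so tightness leaves room for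
  three.\<close>

lemma half_chorded_tight_cuts:
  assumes tight: "(\<Sum>i\<in>{0..<k}. cut B i (i + d) - cut B i (i + 1)) = k - 3"
    and ij: "i < j" "j < i + k"
  shows "B i = B (i + 1) \<or> B j = B (j + 1) \<or> B (i + 1) = B j \<or> B (j + 1) = B i"
proof (rule ccontr)
  assume no: "\<not> ?thesis"
  have "B (i + 1) \<noteq> B j" "B (j + 1) \<noteq> B (i + k)" using no per[of i] by auto
  then obtain s t where s: "i + 1 \<le> s" "s < j" "B s \<noteq> B (s + 1)"
    and t: "j + 1 \<le> t" "t < i + k" "B t \<noteq> B (t + 1)"
    using cut_between[of "i + 1" j B] cut_between[of "j + 1" "i + k" B] ij
    by (metis zless_imp_add1_zle)
  have "real (card {i, s, j, t}) \<le> (\<Sum>i\<in>{0..<k}. cut B i (i + 1))"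
    using s t no ij by (intro card_le_sum_cut[of _ i]) auto
  moreover have "card {i, s, j, t} = 4" using s t by simp
  ultimately show False using sum_cut_le[of d] tight by (simp add: sum_subtractf)
qed

text \<open>The ends of a chord are d steps apart one way and d + 1 the other, so no run of at most
  d indices contains both: all k chords are cut. The size conditions exclude empty runs, since two
  runs cover at most 2 * d < k indices.\<close>

lemma half_chorded_tight_three:
  assumes kd: "k = 2 * d + 1"
    and sizes: "m1 \<le> d" "m2 \<le> d" "k - m1 - m2 \<le> d"
    and B: "\<And>i. s \<le> i \<Longrightarrow> i < s + m1 \<Longrightarrow> B i = \<alpha>"
      "\<And>i. s + m1 \<le> i \<Longrightarrow> i < s + m1 + m2 \<Longrightarrow> B i = \<beta>"
      "\<And>i. s + m1 + m2 \<le> i \<Longrightarrow> i < s + k \<Longrightarrow> B i = \<gamma>"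
    and neq: "\<alpha> \<noteq> \<beta>" "\<beta> \<noteq> \<gamma>" "\<alpha> \<noteq> \<gamma>"
  shows "(\<Sum>i\<in>{0..<k}. cut B i (i + d) - cut B i (i + 1)) = k - 3"
proof -
  have per': "B i = B (i - k)" for i using per[of "i - k"] by simp
  have val: "B i = (if i < s + m1 then \<alpha> else if i < s + m1 + m2 then \<beta> else \<gamma>)"
    if "s \<le> i" "i < s + k" for i using B that by auto
  \<comment> \<open>A chord starting in the window may end in the next period.\<close>
  have val': "B i = (if i - k < s + m1 then \<alpha> else if i - k < s + m1 + m2 then \<beta> else \<gamma>)"
    if "s + k \<le> i" "i < s + k + k" for i
    unfolding per'[of i] by (rule val) (use that in auto)
  have "cut B i (i + d) = 1" if "i \<in> {s..<s + k}" for i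
  proof (cases "i + d < s + k")
    case True
    then show ?thesis using that kd sizes neq val[of i] val[of "i + d"] by (auto simp: cut_def)
  next
    case False
    then show ?thesis using that kd sizes neq val[of i] val'[of "i + d"] by (auto simp: cut_def)
  qed
  then have "(\<Sum>i\<in>{s..<s + k}. cut B i (i + d)) = k" using k by simp
  moreover have "(\<Sum>i\<in>{s..<s + k}. cut B i (i + 1)) = (\<Sum>i\<in>{s..<s + k}.
    (if i = s + m1 - 1 then 1 else 0) + (if i = s + m1 + m2 - 1 then 1 else 0) + (if i = s + k - 1 then 1 else 0))"
  proof (rule sum.cong[OF refl])
    fix i assume i: "i \<in> {s..<s + k}"
    show "cut B i (i + 1) = (if i = s + m1 - 1 then 1 else 0) + (if i = s + m1 + m2 - 1 then 1 else 0)
        + (if i = s + k - 1 then 1 else 0)"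
    proof (cases "i + 1 < s + k")
      case True
      then show ?thesis using i kd sizes neq val[of i] val[of "i + 1"] by (auto simp: cut_def)
    next
      case False
      then show ?thesis using i kd sizes neq val[of i] val'[of "i + 1"] by (auto simp: cut_def)
    qed
  qed
  moreover have "\<dots> = 3" using kd sizes by (simp add: sum.distrib)
  ultimately show ?thesis by (simp add: sum_subtractf cut_window)
qed

text \<open>The run of d + 1 indices contains one chord, from its first index s + d to its last.
  Hence k - 1 chords are cut, against two cuts.\<close>

lemma half_chorded_tight_two:
  assumes kd: "k = 2 * d + 1" "1 \<le> d"
    and B: "\<And>i. s \<le> i \<Longrightarrow> i < s + d \<Longrightarrow> B i = \<alpha>"
      "\<And>i. s + d \<le> i \<Longrightarrow> i < s + k \<Longrightarrow> B i = \<beta>"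
    and neq: "\<alpha> \<noteq> \<beta>"
  shows "(\<Sum>i\<in>{0..<k}. cut B i (i + d) - cut B i (i + 1)) = k - 3"
proof -
  have per': "B i = B (i - k)" for i using per[of "i - k"] by simp
  have val: "B i = (if i < s + d then \<alpha> else \<beta>)"
    if "s \<le> i" "i < s + k" for i using B that by auto
  have val': "B i = (if i - k < s + d then \<alpha> else \<beta>)"
    if "s + k \<le> i" "i < s + k + k" for i
    unfolding per'[of i] by (rule val) (use that in auto)
  have "(\<Sum>i\<in>{s..<s + k}. cut B i (i + d)) = (\<Sum>i\<in>{s..<s + k}. 1 - (if i = s + d then 1 else 0))"
  proof (rule sum.cong[OF refl])
    fix i assume i: "i \<in> {s..<s + k}"
    show "cut B i (i + d) = 1 - (if i = s + d then 1 else 0)"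
    proof (cases "i + d < s + k")
      case True
      then show ?thesis using i kd neq val[of i] val[of "i + d"] by (auto simp: cut_def)
    next
      case False
      then show ?thesis using i kd neq val[of i] val'[of "i + d"] by (auto simp: cut_def)
    qed
  qed
  moreover have "\<dots> = k - 1" using kd by (simp add: sum_subtractf)
  moreover have "(\<Sum>i\<in>{s..<s + k}. cut B i (i + 1)) = (\<Sum>i\<in>{s..<s + k}.
    (if i = s + d - 1 then 1 else 0) + (if i = s + k - 1 then 1 else 0))"
  proof (rule sum.cong[OF refl])
    fix i assume i: "i \<in> {s..<s + k}"
    show "cut B i (i + 1) = (if i = s + d - 1 then 1 else 0) + (if i = s + k - 1 then 1 else 0)"
    proof (cases "i + 1 < s + k")
      case True
      then show ?thesis using i kd neq val[of i] val[of "i + 1"] by (auto simp: cut_def)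
    next
      case False
      then show ?thesis using i kd neq val[of i] val'[of "i + 1"] by (auto simp: cut_def)
    qed
  qed
  moreover have "\<dots> = 2" using kd by (simp add: sum.distrib)
  ultimately show ?thesis by (simp add: sum_subtractf cut_window)
qed

end

section \<open>Sequences winding once around the cycle\<close>

definition half_chorded :: "int \<Rightarrow> int \<Rightarrow> (int \<Rightarrow> 'n::nontriv mod_ring) \<Rightarrow> real ^ 'n vpair \<Rightarrow> real" where
  "half_chorded k d W x =
    (\<Sum>i\<in>{0..<k}. x $ vpair (W i) (W (i + d)) - x $ vpair (W i) (W (i + 1)))"

lemma linear_half_chorded: "linear (half_chorded k d W)"
  by (rule linearI)
    (simp_all add: half_chorded_def sum.distrib sum_subtractf sum_distrib_left right_diff_distrib)

definition cut_vec :: "'n::nontriv mod_ring set set \<Rightarrow> real ^ 'n vpair" where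
  "cut_vec P = char_vec (lifted_multicut P)"

text \<open>As a function of the vertex it yields the word \<open>block_of P \<circ> W\<close>, to
  which the counting of cuts applies.\<close>

definition block_of :: "'v set set \<Rightarrow> 'v \<Rightarrow> 'v set" where
  "block_of P a = {b. same_block P a b}"

lemma block_of_eq_iff:
  assumes "partition_on UNIV P"
  shows "block_of P a = block_of P b \<longleftrightarrow> same_block P a b"
proof
  assume "block_of P a = block_of P b"
  moreover have "b \<in> block_of P b" unfolding block_of_def using same_block_refl[OF assms] by simp
  ultimately show "same_block P a b" unfolding block_of_def by blast
next
  assume "same_block P a b"
  then have "same_block P a c \<longleftrightarrow> same_block P b c" for c
    using same_block_trans[OF assms] same_block_sym by metis
  then show "block_of P a = block_of P b" unfolding block_of_def by blast
qed

lemma half_chorded_cut_vec: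
  assumes P: "partition_on UNIV P" and W: "\<And>i. W i \<noteq> W (i + d)" "\<And>i. W i \<noteq> W (i + 1)"
  shows "half_chorded k d W (cut_vec P) =
    (\<Sum>i\<in>{0..<k}. cut (block_of P \<circ> W) i (i + d) - cut (block_of P \<circ> W) i (i + 1))"
  unfolding half_chorded_def cut_vec_def
  by (intro sum.cong refl) (simp add: char_vec_lifted_multicut[OF P] W cut_def block_of_eq_iff[OF P])

text \<open>A cyclic sequence running once around the cycle, in direction \<open>\<sigma>\<close>, lifted to the universal
  cover: \<open>g\<close> gives the positions on the line, where going once around adds \<open>n\<close>.\<close>

locale winding_sequence =
  fixes k d :: int and W :: "int \<Rightarrow> 'n::nontriv mod_ring" and g :: "int \<Rightarrow> int" and \<sigma> n :: int
  assumes n_def: "n = int CARD('n)" and kd: "k = 2 * d + 1" and d: "2 \<le> d"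
    and \<sigma>: "\<sigma> = 1 \<or> \<sigma> = -1"
    and g_step: "g i < g (i + 1)"
    and g_per: "g (i + k) = g i + n"
    and W_def: "W i = of_int (\<sigma> * g i)"
begin

definition \<phi> :: "int \<Rightarrow> 'n mod_ring" where "\<phi> t = of_int (\<sigma> * t)"

lemma k_pos: "0 < k" using kd d by simp

lemma g_mono: "i < j \<Longrightarrow> g i < g j"
proof (induction j rule: int_gr_induct)
  case base then show ?case by (rule g_step)
next
  case (step j) then show ?case using g_step[of j] by simp
qed

lemma g_less_iff: "g i < g j \<longleftrightarrow> i < j"
  using g_mono[of i j] g_mono[of j i] by (cases i j rule: linorder_cases) auto

lemma g_le_iff: "g i \<le> g j \<longleftrightarrow> i \<le> j"
  using g_less_iff[of j i] by linarith

lemma g_eq_iff: "g i = g j \<longleftrightarrow> i = j"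
  using g_le_iff[of i j] g_le_iff[of j i] by auto

lemma g_add_mult: "g (i + k * q) = g i + n * q"
proof (induction q rule: int_induct[where k = 0])
  case base then show ?case by simp
next
  case (step1 q)
  then show ?case using g_per[of "i + k * q"] by (simp add: algebra_simps)
next
  case (step2 q)
  then show ?case using g_per[of "i + k * (q - 1)"] by (simp add: algebra_simps)
qed

lemma \<phi>_eq_iff: "\<phi> s = \<phi> t \<longleftrightarrow> n dvd s - t"
  using \<sigma> unfolding \<phi>_def of_int_mod_ring_eq_iff n_def by (auto simp: dvd_diff_commute)

lemma \<phi>_add [simp]: "\<phi> (t + n) = \<phi> t" by (simp add: \<phi>_eq_iff)

lemma W_\<phi>: "W i = \<phi> (g i)" by (simp add: W_def \<phi>_def)

lemma W_per: "W (i + k) = W i" by (simp add: W_\<phi> g_per)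

text \<open>Over one period \<open>g\<close> rises by n in strict steps, so two positions less than
  k indices apart are congruent modulo n only if they coincide.\<close>

lemma W_eq_iff: "W i = W j \<longleftrightarrow> k dvd i - j"
proof
  assume "W i = W j"
  define r where "r = (i - j) mod k"
  have r: "0 \<le> r" "r < k" using k_pos by (auto simp: r_def)
  have "W (j + r + k * ((i - j) div k)) = W (j + r)"
    using periodic_add_mult[of W k, OF W_per] .
  moreover have "j + r + k * ((i - j) div k) = i" by (simp add: r_def)
  ultimately have "W i = W (j + r)" by simp
  then have "n dvd g (j + r) - g j" using \<open>W i = W j\<close> by (metis W_\<phi> \<phi>_eq_iff)
  moreover have "g j \<le> g (j + r)" "g (j + r) < g (j + k)" using r by (auto simp: g_le_iff g_less_iff)
  ultimately have "g (j + r) = g j"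
    using g_per[of j] zdvd_imp_le[of n "g (j + r) - g j"] by (cases "g (j + r) = g j") auto
  then have "r = 0" by (simp add: g_eq_iff)
  then show "k dvd i - j" by (simp add: r_def dvd_eq_mod_eq_0)
next
  assume "k dvd i - j"
  then obtain q where "i = j + k * q" by (metis add.commute diff_add_cancel dvdE)
  then show "W i = W j" using periodic_add_mult[of W k, OF W_per] by simp
qed

lemma not_dvd_k: "0 < j \<Longrightarrow> j < k \<Longrightarrow> \<not> k dvd j" by (rule zdvd_not_zless)

lemma W_neq: "0 < j \<Longrightarrow> j < k \<Longrightarrow> W i \<noteq> W (i + j)"
  using not_dvd_k[of j] by (simp add: W_eq_iff)

lemma first_label:
  obtains s where "g (s - 1) < p" "p \<le> g s"
proof -
  have n1: "1 \<le> n" using zero_less_card_finite[where 'a='n] n_def by linarith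
  \<comment> \<open>Moving by q periods changes \<open>g\<close> by n * q \<ge> q, enough to get
    from \<open>g 0\<close> past \<open>p\<close> in either direction.\<close>
  define q where "q = \<bar>p\<bar> + \<bar>g 0\<bar> + 1"
  have "p - g 0 < q" "g 0 - p < q" "0 < q" unfolding q_def by linarith+
  moreover from this have "q \<le> n * q" using n1 by (simp add: mult_le_cancel_right1)
  moreover have "g (k * q) = g 0 + n * q" "g (k * - q) = g 0 - n * q"
    using g_add_mult[of 0 q] g_add_mult[of 0 "- q"] by auto
  ultimately have "g (k * - q) < p" "p \<le> g (k * q)" by linarith+
  moreover have "k * - q \<le> k * q" using k_pos by (simp add: q_def)
  ultimately obtain t where "(g t < p) \<noteq> (g (t + 1) < p)"
    using cut_between[of "k * - q" "k * q" "\<lambda>i. g i < p"] by (metis linorder_not_le)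
  then have "g t < p" "p \<le> g (t + 1)" using g_step[of t] by auto
  then show ?thesis using that[of "t + 1"] by simp
qed

lemma sum_labels:
  fixes F :: "int \<Rightarrow> real"
  assumes "finite T" "\<And>t. t \<notin> range g \<Longrightarrow> F t = 0"
  shows "(\<Sum>t\<in>T. F t) = (\<Sum>r\<in>{r. g r \<in> T}. F (g r))"
proof -
  have "(\<Sum>r\<in>{r. g r \<in> T}. F (g r)) = (\<Sum>t\<in>g ` {r. g r \<in> T}. F t)"
    by (subst sum.reindex) (auto simp: inj_on_def g_eq_iff)
  also have "\<dots> = (\<Sum>t\<in>T. F t)"
  proof (rule sum.mono_neutral_left)
    show "\<forall>t\<in>T - g ` {r. g r \<in> T}. F t = 0"
    proof
      fix t assume "t \<in> T - g ` {r. g r \<in> T}"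
      then have "t \<notin> range g" by auto
      then show "F t = 0" by (rule assms(2))
    qed
  qed (use assms(1) in auto)
  finally show ?thesis by simp
qed

section \<open>Convex labellings of a window and the vertices they define\<close>

definition convex_on_window :: "int \<Rightarrow> (int \<Rightarrow> int) \<Rightarrow> bool" where
  "convex_on_window p h \<longleftrightarrow>
     (\<forall>s t u. p \<le> s \<and> s < u \<and> u < t \<and> t < p + n \<and> h s = h t \<longrightarrow> h u = h s)"

text \<open>\<open>h\<close> is meant on the window only, so a position is first reduced to its
  representative there. This makes the word periodic with period k.\<close>

definition label_block :: "int \<Rightarrow> (int \<Rightarrow> int) \<Rightarrow> int \<Rightarrow> int" where
  "label_block p h i = h (p + (g i - p) mod n)"

lemma label_block_per: "label_block p h (i + k) = label_block p h i"
  by (simp add: label_block_def g_per add_diff_eq[symmetric] mod_simps)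
   (metis add_diff_eq add.commute mod_add_self1)

lemma label_block_eq: "p \<le> g i \<Longrightarrow> g i < p + n \<Longrightarrow> label_block p h i = h (g i)"
  by (simp add: label_block_def)

definition tight_labelling :: "int \<Rightarrow> (int \<Rightarrow> int) \<Rightarrow> bool" where
  "tight_labelling p h \<longleftrightarrow> convex_on_window p h \<and>
     (\<Sum>i\<in>{0..<k}. cut (label_block p h) i (i + d) - cut (label_block p h) i (i + 1)) = k - 3"

text \<open>Inside the window all coordinates of the resulting vertex can be read off
  \<open>h\<close>, including those at vertices outside the sequence; comparing two such vertices
  relies on this.\<close>

lemma tight_labelling_cut_vec:
  assumes "tight_labelling p h"
  obtains P where "P \<in> decompositions (cycle_edges :: 'n mod_ring set set)"
    "half_chorded k d W (cut_vec P) = k - 3"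
    "\<And>s t. s \<in> {p..<p + n} \<Longrightarrow> t \<in> {p..<p + n} \<Longrightarrow> s \<noteq> t \<Longrightarrow>
      cut_vec P $ vpair (\<phi> s) (\<phi> t) = (if h s = h t then 0 else 1)"
proof -
  have conv: "h u = h s" if "s \<in> {p..<p + n}" "t \<in> {p..<p + n}" "s < u" "u < t" "h s = h t" for s t u
  proof -
    have "p \<le> s \<and> s < u \<and> u < t \<and> t < p + n \<and> h s = h t" using that by simp
    then show ?thesis using assms unfolding tight_labelling_def convex_on_window_def by blast
  qed
  have "\<exists>P \<in> decompositions (cycle_edges :: 'n mod_ring set set).
      \<forall>s\<in>{p..<p + n}. \<forall>t\<in>{p..<p + n}. same_block P (\<phi> s) (\<phi> t) \<longleftrightarrow> h s = h t"
    by (rule decomposition_of_convex_labelling[OF \<sigma>, of p h, where 'n='n, folded n_def \<phi>_def])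
      (rule conv)
  then obtain P where P: "P \<in> decompositions (cycle_edges :: 'n mod_ring set set)"
    and same: "\<And>s t. s \<in> {p..<p + n} \<Longrightarrow> t \<in> {p..<p + n} \<Longrightarrow>
      same_block P (\<phi> s) (\<phi> t) \<longleftrightarrow> h s = h t"
    by blast
  have part: "partition_on UNIV P" using P by (simp add: decompositions_def)
  have neq: "\<phi> s \<noteq> \<phi> t" if "s \<in> {p..<p + n}" "t \<in> {p..<p + n}" "s \<noteq> t" for s t
    using that bij_betw_window[OF \<sigma>, of p, where 'n='n, folded n_def \<phi>_def]
    by (auto simp: bij_betw_def inj_on_def)
  have rep: "W i = \<phi> (p + (g i - p) mod n)" "p + (g i - p) mod n \<in> {p..<p + n}" for i
  proof -
    have "n dvd (g i - p) - (g i - p) mod n" by (rule dvd_minus_mod)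
    then show "W i = \<phi> (p + (g i - p) mod n)" by (simp add: W_\<phi> \<phi>_eq_iff algebra_simps)
    have "0 < n" unfolding n_def by simp
    then show "p + (g i - p) mod n \<in> {p..<p + n}" by simp
  qed
  have "cut (block_of P \<circ> W) i j = cut (label_block p h) i j" for i j
    using same[OF rep(2)[of i] rep(2)[of j]]
    unfolding cut_def label_block_def o_def block_of_eq_iff[OF part] rep(1)[of i] rep(1)[of j] by simp
  moreover have "W i \<noteq> W (i + d)" "W i \<noteq> W (i + 1)" for i
    using W_neq[of d i] W_neq[of 1 i] d kd by auto
  ultimately have "half_chorded k d W (cut_vec P) = k - 3"
    using assms unfolding tight_labelling_def by (simp add: half_chorded_cut_vec[OF part])
  moreover have "cut_vec P $ vpair (\<phi> s) (\<phi> t) = (if h s = h t then 0 else 1)"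
    if "s \<in> {p..<p + n}" "t \<in> {p..<p + n}" "s \<noteq> t" for s t
    unfolding cut_vec_def char_vec_lifted_multicut[OF part neq[OF that]] using same[OF that(1,2)] by simp
  ultimately show ?thesis using that[OF P] by blast
qed

end

section \<open>Labellings with two or three arcs that are tight\<close>

context winding_sequence
begin

lemma window_labels:
  assumes "g (s - 1) < p" "p \<le> g s" "s \<le> i" "i < s + k"
  shows "p \<le> g i" "g i < p + n"
proof -
  show "p \<le> g i" using assms g_le_iff[of s i] by simp
  have "g i \<le> g (s - 1 + k)" using assms by (simp add: g_le_iff)
  then show "g i < p + n" using assms(1) g_per[of "s - 1"] by simp
qed

lemma tight_labelling_three:
  assumes conv: "convex_on_window p h" and s: "g (s - 1) < p" "p \<le> g s"
    and sizes: "0 \<le> m1" "0 \<le> m2" "m1 \<le> d" "m2 \<le> d" "k - m1 - m2 \<le> d" "m1 + m2 \<le> k"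
    and h: "\<And>i. s \<le> i \<Longrightarrow> i < s + m1 \<Longrightarrow> h (g i) = \<alpha>"
      "\<And>i. s + m1 \<le> i \<Longrightarrow> i < s + m1 + m2 \<Longrightarrow> h (g i) = \<beta>"
      "\<And>i. s + m1 + m2 \<le> i \<Longrightarrow> i < s + k \<Longrightarrow> h (g i) = \<gamma>"
    and neq: "\<alpha> \<noteq> \<beta>" "\<beta> \<noteq> \<gamma>" "\<alpha> \<noteq> \<gamma>"
  shows "tight_labelling p h"
  unfolding tight_labelling_def
proof (intro conjI conv half_chorded_tight_three[where s = s and ?m1.0 = m1 and ?m2.0 = m2
      and \<alpha> = \<alpha> and \<beta> = \<beta> and \<gamma> = \<gamma>])
  have lb: "label_block p h i = h (g i)" if "s \<le> i" "i < s + k" for i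
    using window_labels[OF s that] by (rule label_block_eq)
  show "label_block p h i = \<alpha>" if "s \<le> i" "i < s + m1" for i
    using that sizes h(1)[of i] lb[of i] by simp
  show "label_block p h i = \<beta>" if "s + m1 \<le> i" "i < s + m1 + m2" for i
    using that sizes h(2)[of i] lb[of i] by simp
  show "label_block p h i = \<gamma>" if "s + m1 + m2 \<le> i" "i < s + k" for i
    using that sizes h(3)[of i] lb[of i] by simp
qed (use label_block_per k_pos kd sizes neq in auto)

text \<open>Beside an arc with d labels, the other d + 1 labels may be divided arbitrarily between
  two arcs. If both get labels, there are three runs of at most d; for r = s or r = s + d + 1 one
  arc carries no label and the runs have lengths d and d + 1.\<close>

lemma tight_labelling_arcs:
  assumes conv: "convex_on_window p h" and s: "g (s - 1) < p" "p \<le> g s"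
    and r: "s \<le> r" "r \<le> s + d + 1"
    and h: "\<And>i. s \<le> i \<Longrightarrow> i < r \<Longrightarrow> h (g i) = \<alpha>"
      "\<And>i. r \<le> i \<Longrightarrow> i < r + d \<Longrightarrow> h (g i) = \<beta>"
      "\<And>i. r + d \<le> i \<Longrightarrow> i < s + k \<Longrightarrow> h (g i) = \<gamma>"
    and neq: "\<alpha> \<noteq> \<beta>" "\<beta> \<noteq> \<gamma>" "\<alpha> \<noteq> \<gamma>"
  shows "tight_labelling p h"
proof -
  have lb: "label_block p h i = h (g i)" if "s \<le> i" "i < s + k" for i
    using window_labels[OF s that] by (rule label_block_eq)
  consider "r = s" | "s < r" "r \<le> s + d" | "r = s + d + 1" using r by linarith
  then show ?thesis
  proof cases
    case 1
    show ?thesis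
      unfolding tight_labelling_def
    proof (intro conjI conv half_chorded_tight_two[where s = s and \<alpha> = \<beta> and \<beta> = \<gamma>])
      show "label_block p h i = \<beta>" if "s \<le> i" "i < s + d" for i
        using that kd d 1 h(2)[of i] lb[of i] by simp
      show "label_block p h i = \<gamma>" if "s + d \<le> i" "i < s + k" for i
        using that d 1 h(3)[of i] lb[of i] by simp
    qed (use label_block_per k_pos kd d neq in auto)
  next
    case 2
    show ?thesis
      by (rule tight_labelling_three[OF conv s, where ?m1.0 = "r - s" and ?m2.0 = d and \<alpha> = \<alpha> and \<beta> = \<beta> and \<gamma> = \<gamma>])
        (use 2 kd d h neq in auto)
  next
    case 3
    show ?thesis
      unfolding tight_labelling_def
    \<comment> \<open>Read from r on, the word starts with the run of d indices. As r + d = s + k,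
      the remaining d + 1 are those from s to r - 1 one period later.\<close>
    proof (intro conjI conv half_chorded_tight_two[where s = r and \<alpha> = \<beta> and \<beta> = \<alpha>])
      show "label_block p h i = \<beta>" if "r \<le> i" "i < r + d" for i
        using that kd d 3 h(2)[of i] lb[of i] by simp
      show "label_block p h i = \<alpha>" if "r + d \<le> i" "i < r + k" for i
        using that kd d 3 h(1)[of "i - k"] lb[of "i - k"] label_block_per[of p h "i - k"] by simp
    qed (use label_block_per k_pos kd d neq in auto)
  qed
qed

end

section \<open>Coefficients at vertices outside the sequence\<close>

locale orthogonal_to_tight = winding_sequence k d W g \<sigma> n
  for k d and W :: "int \<Rightarrow> 'n::nontriv mod_ring" and g \<sigma> n +
  fixes c :: "real ^ 'n vpair"
  assumes orth: "\<And>P. P \<in> decompositions (cycle_edges :: 'n mod_ring set set) \<Longrightarrow>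
    half_chorded k d W (cut_vec P) = k - 3 \<Longrightarrow> c \<bullet> cut_vec P = 0"
begin

text \<open>The two vertices agree on all pairs avoiding \<open>u\<close>, so their difference
  paired with \<open>c\<close> retains only the pairs of \<open>u\<close> with members of its old
  and of its new block.\<close>

lemma move_vertex:
  assumes tight: "tight_labelling p h" "tight_labelling p h'" and u: "u \<in> {p..<p + n}"
    and eq: "\<And>t. t \<in> {p..<p + n} \<Longrightarrow> t \<noteq> u \<Longrightarrow> h' t = h t"
  shows "(\<Sum>t\<in>{t \<in> {p..<p + n} - {u}. h t = h u}. c $ vpair (\<phi> u) (\<phi> t)) =
    (\<Sum>t\<in>{t \<in> {p..<p + n} - {u}. h' t = h' u}. c $ vpair (\<phi> u) (\<phi> t))"
proof -
  let ?I = "{p..<p + n}" and ?C = "\<lambda>t. c $ vpair (\<phi> u) (\<phi> t)"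
  obtain P where P: "P \<in> decompositions (cycle_edges :: 'n mod_ring set set)"
    "half_chorded k d W (cut_vec P) = k - 3"
    and x: "\<And>s t. s \<in> ?I \<Longrightarrow> t \<in> ?I \<Longrightarrow> s \<noteq> t \<Longrightarrow>
      cut_vec P $ vpair (\<phi> s) (\<phi> t) = (if h s = h t then 0 else 1)"
    by (rule tight_labelling_cut_vec[OF tight(1)]) blast
  obtain P' where P': "P' \<in> decompositions (cycle_edges :: 'n mod_ring set set)"
    "half_chorded k d W (cut_vec P') = k - 3"
    and x': "\<And>s t. s \<in> ?I \<Longrightarrow> t \<in> ?I \<Longrightarrow> s \<noteq> t \<Longrightarrow>
      cut_vec P' $ vpair (\<phi> s) (\<phi> t) = (if h' s = h' t then 0 else 1)"
    by (rule tight_labelling_cut_vec[OF tight(2)]) blast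
  have bij: "bij_betw \<phi> ?I UNIV"
    using bij_betw_window[OF \<sigma>, of p, where 'n='n, folded n_def \<phi>_def] .
  then have inj: "\<phi> s = \<phi> t \<longleftrightarrow> s = t" if "s \<in> ?I" "t \<in> ?I" for s t
    using that by (auto simp: bij_betw_def inj_on_def)
  define D where "D e = c $ e * (cut_vec P' $ e - cut_vec P $ e)" for e
  let ?E = "(\<lambda>t. vpair (\<phi> u) (\<phi> t)) ` (?I - {u})"
  have "0 = c \<bullet> cut_vec P' - c \<bullet> cut_vec P" using orth P P' by simp
  also have "\<dots> = (\<Sum>e\<in>UNIV. D e)"
    by (simp add: inner_vec_def D_def sum_subtractf right_diff_distrib)
  also have "\<dots> = (\<Sum>e\<in>?E. D e)"
  proof (rule sum.mono_neutral_right)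
    show "\<forall>e\<in>UNIV - ?E. D e = 0"
    proof
      fix e assume e: "e \<in> UNIV - ?E"
      obtain a b where ab: "a \<noteq> b" "e = vpair a b" by (rule vpair_cases)
      have "a \<in> \<phi> ` ?I" "b \<in> \<phi> ` ?I" using bij by (auto simp: bij_betw_def)
      then obtain s t where st: "a = \<phi> s" "b = \<phi> t" "s \<in> ?I" "t \<in> ?I" by blast
      then have "s \<noteq> t" using ab by auto
      have "e \<noteq> vpair (\<phi> u) (\<phi> r)" if "r \<in> ?I" "r \<noteq> u" for r using e that by auto
      then have "s \<noteq> u" "t \<noteq> u" using ab st \<open>s \<noteq> t\<close> vpair_commute[of a b] by metis+
      with \<open>s \<noteq> t\<close> have "cut_vec P' $ e = cut_vec P $ e"
        using x[of s t] x'[of s t] eq[of s] eq[of t] st ab by simp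
      then show "D e = 0" by (simp add: D_def)
    qed
  qed auto
  also have "\<dots> = (\<Sum>t\<in>?I - {u}. D (vpair (\<phi> u) (\<phi> t)))"
  proof (subst sum.reindex)
    show "inj_on (\<lambda>t. vpair (\<phi> u) (\<phi> t)) (?I - {u})"
    proof (rule inj_onI)
      fix s t assume "s \<in> ?I - {u}" "t \<in> ?I - {u}" "vpair (\<phi> u) (\<phi> s) = vpair (\<phi> u) (\<phi> t)"
      then show "s = t"
        using vpair_eq_iff[of "\<phi> u" "\<phi> s" "\<phi> u" "\<phi> t"] inj[of s t] inj[of u s] inj[of u t] u by auto
    qed
  qed simp
  also have "\<dots> = (\<Sum>t\<in>?I - {u}. (if h t = h u then ?C t else 0) - (if h' t = h' u then ?C t else 0))"
  proof (rule sum.cong[OF refl])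
    fix t assume "t \<in> ?I - {u}"
    then show "D (vpair (\<phi> u) (\<phi> t)) = (if h t = h u then ?C t else 0) - (if h' t = h' u then ?C t else 0)"
      using x[of u t] x'[of u t] u unfolding D_def by auto
  qed
  also have "\<dots> = (\<Sum>t\<in>{t \<in> ?I - {u}. h t = h u}. ?C t) - (\<Sum>t\<in>{t \<in> ?I - {u}. h' t = h' u}. ?C t)"
    unfolding sum_subtractf by (subst (1 2) sum.inter_filter[symmetric]) auto
  finally show ?thesis by simp
qed

text \<open>A vertex outside the sequence can become a block of its own without changing the word.
  The bound on q keeps the labels between p and q to at most d + 1, as a tight labelling with d
  labels in the next arc demands.\<close>

lemma sum_from_nonlabel:
  assumes s: "g (s - 1) < p" "p < g s" and q: "p < q" "q < g (s + d + 1)"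
  shows "(\<Sum>t\<in>{p<..q}. c $ vpair (\<phi> p) (\<phi> t)) = 0"
proof -
  obtain r where r: "g (r - 1) < q + 1" "q + 1 \<le> g r" by (rule first_label)
  have "g (r - 1) < g (s + d + 1)" "g (s - 1) < g r" using r q s by linarith+
  then have r': "s \<le> r" "r \<le> s + d + 1" by (simp_all add: g_less_iff)
  have low: "g i \<le> q" if "i < r" for i using that r(1) g_le_iff[of i "r - 1"] by linarith
  have high: "q < g i" if "r \<le> i" for i using that r(2) g_le_iff[of r i] by linarith
  have "g (s + d + 1) \<le> g (s - 1 + k)" using kd d by (simp add: g_le_iff)
  then have qn: "q < p + n" using q s(1) g_per[of "s - 1"] by linarith
  \<comment> \<open>The value -1 is a fresh label isolating \<open>p\<close>; as \<open>p\<close>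
    opens the window, \<open>h'\<close> stays convex.\<close>
  define h h' :: "int \<Rightarrow> int" where "h t = (if t \<le> q then 0 else if t < g (r + d) then 1 else 2)"
    and "h' t = (if t = p then -1 else h t)" for t
  have val: "h (g i) = (if i < r then 0 else if i < r + d then 1 else 2)" for i
    using low[of i] high[of i] by (cases "i < r") (auto simp: h_def g_less_iff)
  have val': "h' (g i) = h (g i)" if "s \<le> i" for i
    using that s g_le_iff[of s i] by (auto simp: h'_def)
  have conv: "convex_on_window p h" by (auto simp: convex_on_window_def h_def)
  have conv': "convex_on_window p h'" by (auto simp: convex_on_window_def h_def h'_def)
  have "tight_labelling p h"
    by (rule tight_labelling_arcs[OF conv s(1) less_imp_le[OF s(2)] r', of 0 1 2]) (use r' d val in auto)
  moreover have "tight_labelling p h'"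
    by (rule tight_labelling_arcs[OF conv' s(1) less_imp_le[OF s(2)] r', of 0 1 2]) (use r' d val val' in auto)
  ultimately have "(\<Sum>t\<in>{t \<in> {p..<p + n} - {p}. h t = h p}. c $ vpair (\<phi> p) (\<phi> t)) =
    (\<Sum>t\<in>{t \<in> {p..<p + n} - {p}. h' t = h' p}. c $ vpair (\<phi> p) (\<phi> t))"
    by (rule move_vertex) (use q qn in \<open>auto simp: h'_def\<close>)
  moreover have "{t \<in> {p..<p + n} - {p}. h t = h p} = {p<..q}" using q qn by (auto simp: h_def)
  moreover have "{t \<in> {p..<p + n} - {p}. h' t = h' p} = {}" by (auto simp: h_def h'_def)
  ultimately show ?thesis by (simp only: sum.empty)
qed

text \<open>The vanishing sums up to q and up to q - 1 differ by this one coefficient.\<close>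

lemma nonlabel_forward:
  assumes s: "g (s - 1) < p" "p < g s" and q: "p < q" "q < g (s + d + 1)"
  shows "c $ vpair (\<phi> p) (\<phi> q) = 0"
proof (cases "q = p + 1")
  case True
  then have "{p<..q} = {q}" by auto
  then show ?thesis using sum_from_nonlabel[OF assms] by simp
next
  case False
  then have "{p<..q} = insert q {p<..q - 1}" using q by auto
  then show ?thesis
    using sum_from_nonlabel[OF assms] sum_from_nonlabel[OF s, of "q - 1"] q False by simp
qed

end

section \<open>Coefficients of equations satisfied by all tight vertices\<close>

context winding_sequence
begin

lemma half_chorded_reflect: "half_chorded k d (\<lambda>i. W (- i)) x = half_chorded k d W x"
proof -
  have per: "W (i + k + j) = W (i + j)" for i j using W_per[of "i + j"] by (simp add: algebra_simps)
  have "(\<Sum>i\<in>{0..<k}. x $ vpair (W (- i)) (W (- (i + j)))) = (\<Sum>i\<in>{0..<k}. x $ vpair (W i) (W (i + j)))" for j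
  proof -
    define f where "f i = x $ vpair (W i) (W (i + j))" for i
    have "x $ vpair (W (- i)) (W (- (i + j))) = f (- j - i)" for i
    proof -
      have "- (i + j) = - j - i" by simp
      then show ?thesis by (simp only: f_def) (simp add: vpair_commute)
    qed
    moreover have "f (i + k) = f i" for i by (simp add: f_def W_per per)
    ultimately show ?thesis using sum_periodic_reflect[of f k "- j"] k_pos by (simp add: f_def)
  qed
  then show ?thesis unfolding half_chorded_def sum_subtractf by simp
qed

lemma \<phi>_nonlabel:
  assumes "t \<notin> range g" shows "\<phi> t \<notin> range W"
proof
  assume "\<phi> t \<in> range W"
  then obtain i where "\<phi> t = W i" by blast
  then have "n dvd t - g i" by (simp add: W_\<phi> \<phi>_eq_iff)
  then obtain q where "t - g i = n * q" by (rule dvdE)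
  then have "t = g (i + k * q)" by (simp add: g_add_mult)
  then show False using assms by blast
qed

end

context orthogonal_to_tight
begin

text \<open>Reversing the sequence preserves the inequality, so each identity about \<open>c\<close>
  has a mirror image that needs no second proof.\<close>

lemma reflected: "orthogonal_to_tight k d (\<lambda>i. W (- i)) (\<lambda>i. - g (- i)) (- \<sigma>) n c"
proof
  fix i
  show "- g (- i) < - g (- (i + 1))" by (simp add: g_less_iff)
  show "- g (- (i + k)) = - g (- i) + n" using g_per[of "- i - k"] by simp
  show "W (- i) = of_int (- \<sigma> * - g (- i))" by (simp add: W_def)
  show "c \<bullet> cut_vec P = 0"
    if "P \<in> decompositions (cycle_edges :: 'n mod_ring set set)"
      "half_chorded k d (\<lambda>i. W (- i)) (cut_vec P) = k - 3" for P
    using that orth by (simp only: half_chorded_reflect)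
qed (use n_def kd d \<sigma> in auto)

lemma nonlabel_zero:
  assumes a: "a \<notin> range W" and ab: "a \<noteq> b"
  shows "c $ vpair a b = 0"
proof -
  interpret R: orthogonal_to_tight k d "\<lambda>i. W (- i)" "\<lambda>i. - g (- i)" "- \<sigma>" n c
    by (rule reflected)
  have bij: "bij_betw \<phi> {p..<p + n} UNIV" for p
    using bij_betw_window[OF \<sigma>, of p, where 'n='n, folded n_def \<phi>_def] .
  have "a \<in> \<phi> ` {0..<0 + n}" using bij[of 0] by (auto simp: bij_betw_def)
  then obtain p where p: "a = \<phi> p" by blast
  have "b \<in> \<phi> ` {p..<p + n}" using bij[of p] by (auto simp: bij_betw_def)
  then obtain t where t: "b = \<phi> t" "p \<le> t" "t < p + n" by auto
  with ab p have "p < t" by (cases "p = t") auto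
  obtain s where s: "g (s - 1) < p" "p \<le> g s" by (rule first_label)
  have "p \<noteq> g s" using a p W_\<phi> by auto
  then have s': "p < g s" using s by simp
  show ?thesis
  proof (cases "t < g (s + d + 1)")
    case True
    then show ?thesis using nonlabel_forward[OF s(1) s' \<open>p < t\<close>] p t by simp
  next
    case False
    \<comment> \<open>Backwards from p, the mirrored lemma covers all positions after
      \<open>g (s - d - 2)\<close>, which is one turn before \<open>g (s + d - 1)\<close>. With the
      forward range, ending before \<open>g (s + d + 1)\<close>, this exhausts the cycle.\<close>
    have "g (s + d - 1) < g (s + d + 1)" by (simp add: g_less_iff)
    then have "g (s + d - 1) < t" using False by simp
    moreover have "g (s - d - 2) = g (s + d - 1) - n"
      using g_per[of "s - d - 2"] kd by (simp add: algebra_simps)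
    ultimately have "c $ vpair (R.\<phi> (- p)) (R.\<phi> (n - t)) = 0"
      using s s' t kd by (intro R.nonlabel_forward[of "1 - s"]) (auto simp: algebra_simps)
    moreover have "R.\<phi> (- p) = \<phi> p" by (simp add: R.\<phi>_def \<phi>_def)
    moreover have "R.\<phi> (n - t) = \<phi> (t - n)" by (simp add: R.\<phi>_def \<phi>_def algebra_simps)
    moreover have "\<phi> (t - n) = \<phi> t" using \<phi>_add[of "t - n"] by simp
    ultimately show ?thesis using p t by simp
  qed
qed

section \<open>Coefficients between vertices of the sequence\<close>

lemma sum_labels_c:
  assumes "finite T"
  shows "(\<Sum>t\<in>T. c $ vpair (\<phi> (g u)) (\<phi> t)) = (\<Sum>r\<in>{r. g r \<in> T}. c $ vpair (W u) (W r))"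
proof -
  have "c $ vpair (\<phi> (g u)) (\<phi> t) = 0" if "t \<notin> range g" for t
  proof -
    have "\<phi> t \<notin> range W" using that by (rule \<phi>_nonlabel)
    then have "c $ vpair (\<phi> t) (W u) = 0" by (intro nonlabel_zero) auto
    then show ?thesis by (simp add: W_\<phi> vpair_commute)
  qed
  then show ?thesis using sum_labels[OF assms, of "\<lambda>t. c $ vpair (\<phi> (g u)) (\<phi> t)"] by (simp add: W_\<phi>)
qed

text \<open>The label u passes from the head of a run of d to the end of the preceding run. The run
  lengths change from l, d, d + 1 - l to l + 1, d - 1, d + 1 - l, and the bounds on l keep all of
  them at most d. Only the left-hand side depends on l.\<close>

lemma boundary_move:
  assumes l: "1 \<le> l" "l \<le> d - 1"
  shows "(\<Sum>i\<in>{u - l..<u}. c $ vpair (W u) (W i)) = (\<Sum>i\<in>{u + 1..<u + d}. c $ vpair (W u) (W i))"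
proof -
  define s p where "s = u - l" and "p = g s"
  define h h' :: "int \<Rightarrow> int" where "h t = (if t < g u then 0 else if t < g (u + d) then 1 else 2)"
    and "h' t = (if t \<le> g u then 0 else if t < g (u + d) then 1 else 2)" for t
  have s: "g (s - 1) < p" "p \<le> g s" by (auto simp: p_def g_less_iff)
  have conv: "convex_on_window p h" by (auto simp: convex_on_window_def h_def)
  have conv': "convex_on_window p h'" by (auto simp: convex_on_window_def h'_def)
  have "g (u + d) \<le> g (s + k)" using l kd by (simp add: g_le_iff s_def)
  then have un: "g (u + d) \<le> p + n" by (simp add: g_per p_def)
  have u: "p < g u" "g u < g (u + d)" using l d by (auto simp: p_def s_def g_less_iff)
  have "tight_labelling p h"
    by (rule tight_labelling_arcs[OF conv s, of u 0 1 2])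
      (use l d in \<open>auto simp: s_def h_def g_less_iff\<close>)
  moreover have "tight_labelling p h'"
    by (rule tight_labelling_three[OF conv' s, of "l + 1" "d - 1" 0 1 2])
      (use l d kd in \<open>auto simp: s_def h'_def g_less_iff g_le_iff\<close>)
  ultimately have "(\<Sum>t\<in>{t \<in> {p..<p + n} - {g u}. h t = h (g u)}. c $ vpair (\<phi> (g u)) (\<phi> t)) =
    (\<Sum>t\<in>{t \<in> {p..<p + n} - {g u}. h' t = h' (g u)}. c $ vpair (\<phi> (g u)) (\<phi> t))"
    by (rule move_vertex) (use u un in \<open>auto simp: h_def h'_def\<close>)
  moreover have "{t \<in> {p..<p + n} - {g u}. h t = h (g u)} = {g u<..<g (u + d)}"
    using u un by (auto simp: h_def)
  moreover have "{t \<in> {p..<p + n} - {g u}. h' t = h' (g u)} = {p..<g u}"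
    using u un by (auto simp: h'_def)
  moreover have "{r. g r \<in> {g u<..<g (u + d)}} = {u + 1..<u + d}" by (auto simp: g_less_iff)
  moreover have "{r. g r \<in> {p..<g u}} = {u - l..<u}" by (auto simp: g_less_iff g_le_iff p_def s_def)
  ultimately show ?thesis by (simp add: sum_labels_c)
qed

text \<open>Splitting the first label off the longer run turns runs of d + 1 and d into 1, d and d.
  Both are tight, and the new block of \<open>u\<close> is a singleton.\<close>

lemma label_split: "(\<Sum>i\<in>{u + 1..<u + d + 1}. c $ vpair (W u) (W i)) = 0"
proof -
  define p where "p = g u"
  define h h' :: "int \<Rightarrow> int" where "h t = (if t < g (u + d + 1) then 0 else 1)"
    and "h' t = (if t = p then -1 else h t)" for t
  have s: "g (u - 1) < p" "p \<le> g u" by (auto simp: p_def g_less_iff)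
  have conv: "convex_on_window p h" by (auto simp: convex_on_window_def h_def)
  have conv': "convex_on_window p h'" by (auto simp: convex_on_window_def h_def h'_def)
  have "g (u + d + 1) \<le> g (u + k)" using kd d by (simp add: g_le_iff)
  then have un: "g (u + d + 1) \<le> p + n" by (simp add: g_per p_def)
  have u: "p < g (u + d + 1)" using d by (auto simp: p_def g_less_iff)
  have "tight_labelling p h"
    by (rule tight_labelling_arcs[OF conv s, of "u + d + 1" 0 1 2])
      (use kd d in \<open>auto simp: h_def g_less_iff\<close>)
  moreover have "tight_labelling p h'"
    by (rule tight_labelling_arcs[OF conv' s, of "u + 1" "-1" 0 1])
      (use kd d in \<open>auto simp: h_def h'_def p_def g_less_iff g_eq_iff\<close>)
  ultimately have "(\<Sum>t\<in>{t \<in> {p..<p + n} - {p}. h t = h p}. c $ vpair (\<phi> p) (\<phi> t)) =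
    (\<Sum>t\<in>{t \<in> {p..<p + n} - {p}. h' t = h' p}. c $ vpair (\<phi> p) (\<phi> t))"
    by (rule move_vertex) (use u un in \<open>auto simp: h'_def\<close>)
  moreover have "{t \<in> {p..<p + n} - {p}. h t = h p} = {p<..<g (u + d + 1)}"
    using u un by (auto simp: h_def)
  moreover have "{t \<in> {p..<p + n} - {p}. h' t = h' p} = {}" by (auto simp: h_def h'_def)
  moreover have "{r. g r \<in> {p<..<g (u + d + 1)}} = {u + 1..<u + d + 1}" by (auto simp: g_less_iff p_def)
  ultimately show ?thesis
    using sum_labels_c[of "{p<..<g (u + d + 1)}" u] by (simp only: sum.empty p_def finite_greaterThanLessThan_int)
qed

lemma boundary_move_reflected:
  assumes l: "1 \<le> l" "l \<le> d - 1"
  shows "(\<Sum>i\<in>{u + 1..<u + l + 1}. c $ vpair (W u) (W i)) = (\<Sum>i\<in>{u - (d - 1)..<u}. c $ vpair (W u) (W i))"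
proof -
  interpret R: orthogonal_to_tight k d "\<lambda>i. W (- i)" "\<lambda>i. - g (- i)" "- \<sigma>" n c
    by (rule reflected)
  have "(\<Sum>i\<in>{u + 1..<u + l + 1}. c $ vpair (W u) (W i)) =
      (\<Sum>i\<in>{- u - l..<- u}. c $ vpair (W u) (W (- i)))"
    by (rule sum.reindex_bij_witness[of _ uminus uminus]) auto
  also have "\<dots> = (\<Sum>i\<in>{- u + 1..<- u + d}. c $ vpair (W u) (W (- i)))"
    using R.boundary_move[OF l, of "- u"] by simp
  also have "\<dots> = (\<Sum>i\<in>{u - (d - 1)..<u}. c $ vpair (W u) (W i))"
    by (rule sum.reindex_bij_witness[of _ uminus uminus]) auto
  finally show ?thesis .
qed

lemma boundary_move_one:
  "c $ vpair (W u) (W (u - 1)) = (\<Sum>i\<in>{u + 1..<u + d}. c $ vpair (W u) (W i))"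
  "c $ vpair (W u) (W (u + 1)) = (\<Sum>i\<in>{u - (d - 1)..<u}. c $ vpair (W u) (W i))"
proof -
  have "{u - 1..<u} = {u - 1}" "{u + 1..<u + 1 + 1} = {u + 1}" by auto
  then show "c $ vpair (W u) (W (u - 1)) = (\<Sum>i\<in>{u + 1..<u + d}. c $ vpair (W u) (W i))"
    and "c $ vpair (W u) (W (u + 1)) = (\<Sum>i\<in>{u - (d - 1)..<u}. c $ vpair (W u) (W i))"
    using boundary_move[of 1 u] boundary_move_reflected[of 1 u] d by auto
qed

text \<open>The boundary moves for l = 1 and l = d - 1, with their mirror images, equate the
  coefficients of u with u - 1 and with u + 1; hence they are constant along the sequence.\<close>

lemma coefficient_edge: "c $ vpair (W u) (W (u + 1)) = c $ vpair (W 0) (W 1)"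
proof -
  define D where "D i j = c $ vpair (W i) (W j)" for i j
  have step: "D u (u + 1) = D (u - 1) u" for u
  proof -
    have "D u (u - 1) = (\<Sum>i\<in>{u + 1..<u + d}. D u i)"
      unfolding D_def by (rule boundary_move_one)
    also have "\<dots> = (\<Sum>i\<in>{u - (d - 1)..<u}. D u i)"
      using boundary_move[of "d - 1" u] d by (simp add: D_def)
    also have "\<dots> = D u (u + 1)"
      unfolding D_def by (rule boundary_move_one[symmetric])
    finally show ?thesis by (simp add: D_def vpair_commute)
  qed
  have "D u (u + 1) = D 0 1"
  proof (induction u rule: int_induct[where k = 0])
    case (step1 i) then show ?case using step[of "i + 1"] by simp
  next
    case (step2 i) then show ?case using step[of i] by simp
  qed simp
  then show ?thesis by (simp add: D_def)
qed

text \<open>The boundary moves for l = m and l = m - 1 have the same right-hand side, so the one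
  term by which their left-hand sides differ vanishes.\<close>

lemma coefficient_middle:
  assumes "2 \<le> m" "m \<le> d - 1"
  shows "c $ vpair (W u) (W (u + m)) = 0"
proof -
  have "{u + 1..<u + m + 1} = insert (u + m) {u + 1..<u + (m - 1) + 1}" using assms by auto
  then show ?thesis
    using boundary_move_reflected[of m u] boundary_move_reflected[of "m - 1" u] assms by simp
qed

text \<open>By \<open>label_split\<close> the chord cancels the sum over u + 1, ..., u + d - 1, and
  the mirrored boundary move for l = d - 1 identifies that sum with the edge coefficient.\<close>

lemma coefficient_chord: "c $ vpair (W u) (W (u + d)) = - (c $ vpair (W 0) (W 1))"
proof -
  have "{u + 1..<u + d + 1} = insert (u + d) {u + 1..<u + d}" using d by auto
  then have "c $ vpair (W u) (W (u + d)) = - (\<Sum>i\<in>{u + 1..<u + d}. c $ vpair (W u) (W i))"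
    using label_split[of u] by simp
  moreover have "(\<Sum>i\<in>{u + 1..<u + d}. c $ vpair (W u) (W i)) = c $ vpair (W u) (W (u + 1))"
    using boundary_move_reflected[of "d - 1" u] boundary_move_one(2)[of u] d by simp
  ultimately show ?thesis by (simp add: coefficient_edge)
qed

lemma inner_eq_half_chorded: "c \<bullet> x = - (c $ vpair (W 0) (W 1)) * half_chorded k d W x"
proof -
  let ?\<mu> = "c $ vpair (W 0) (W 1)"
  let ?e = "\<lambda>j i. vpair (W i) (W (i + j))"
  have d1: "0 < d" "d < k" "1 < k" using kd d by auto
  have inj: "inj_on (?e j) {0..<k}" if j: "j = 1 \<or> j = d" for j
  proof (rule inj_onI)
    fix i i' assume i: "i \<in> {0..<k}" "i' \<in> {0..<k}" and eq: "?e j i = ?e j i'"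
    have neq: "W i \<noteq> W (i + j)" "W i' \<noteq> W (i' + j)" using j d1 W_neq by auto
    have "W i = W i' \<or> W i = W (i' + j) \<and> W (i + j) = W i'"
      using eq vpair_eq_iff[OF neq] by auto
    then show "i = i'"
    proof
      assume "W i = W i'"
      then have "k dvd i - i'" by (simp add: W_eq_iff)
      then have "i mod k = i' mod k" by (simp add: mod_eq_dvd_iff)
      then show ?thesis using i by simp
    next
      \<comment> \<open>A pair listed from both of its ends would make k divide 2 * j, which is
        positive and at most 2 * d < k.\<close>
      assume "W i = W (i' + j) \<and> W (i + j) = W i'"
      then have "k dvd i + j - i'" "k dvd i - (i' + j)" by (simp_all only: W_eq_iff)
      then have "k dvd i + j - i' - (i - (i' + j))" by (rule dvd_diff)
      then have "k dvd 2 * j" by simp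
      moreover have "\<not> k dvd 2 * j" using j kd d by (intro not_dvd_k) auto
      ultimately show ?thesis by simp
    qed
  qed
  have disj: "?e d ` {0..<k} \<inter> ?e 1 ` {0..<k} = {}"
  proof -
    have "?e d i \<noteq> ?e 1 j" for i j
    proof
      assume eq: "?e d i = ?e 1 j"
      have neq: "W i \<noteq> W (i + d)" "W j \<noteq> W (j + 1)" using d1 W_neq by auto
      consider "W i = W j" "W (i + d) = W (j + 1)" | "W i = W (j + 1)" "W (i + d) = W j"
        using eq vpair_eq_iff[OF neq] by auto
      then show False
      proof cases
        case 1
        then have "k dvd i + d - (j + 1)" "k dvd i - j" by (simp_all only: W_eq_iff)
        then have "k dvd i + d - (j + 1) - (i - j)" by (rule dvd_diff)
        then have "k dvd d - 1" by (simp add: algebra_simps)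
        moreover have "\<not> k dvd d - 1" using kd d by (intro not_dvd_k) auto
        ultimately show False by simp
      next
        case 2
        then have "k dvd i + d - j" "k dvd i - (j + 1)" by (simp_all only: W_eq_iff)
        then have "k dvd i + d - j - (i - (j + 1))" by (rule dvd_diff)
        then have "k dvd d + 1" by (simp add: algebra_simps)
        moreover have "\<not> k dvd d + 1" using kd d by (intro not_dvd_k) auto
        ultimately show False by simp
      qed
    qed
    then show ?thesis by auto
  qed
  have in_image: "?e j i \<in> ?e j ` {0..<k}" for i j
  proof
    have "W (i mod k + j + k * (i div k)) = W (i mod k + j)" by (rule periodic_add_mult[of W k, OF W_per])
    moreover have "i mod k + j + k * (i div k) = i + j" by simp
    ultimately show "?e j i = ?e j (i mod k)"
      using periodic_mod[of W k i, OF W_per] by simp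
  qed (use k_pos in auto)
  have zero: "c $ e = 0" if e: "e \<notin> ?e d ` {0..<k} \<union> ?e 1 ` {0..<k}" for e
  proof -
    obtain a b where ab: "a \<noteq> b" "e = vpair a b" by (rule vpair_cases)
    show ?thesis
    proof (cases "a \<in> range W \<and> b \<in> range W")
      case False
      then show ?thesis
        using nonlabel_zero[of a b] nonlabel_zero[of b a] ab vpair_commute[of a b] by auto
    next
      case True
      then obtain i j where ij: "a = W i" "b = W j" by blast
      define m where "m = (j - i) mod k"
      have "W (i + m + k * ((j - i) div k)) = W (i + m)"
        by (rule periodic_add_mult[of W k, OF W_per])
      moreover have "i + m + k * ((j - i) div k) = j" by (simp add: m_def)
      ultimately have b: "b = W (i + m)" using ij by simp
      have m: "0 \<le> m" "m < k" "m \<noteq> 0" using k_pos ab b ij by (auto simp: m_def)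
      \<comment> \<open>Labels at forward distance m > d are at distance k - m \<le> d in the other
        order.\<close>
      have "\<exists>i m. 1 \<le> m \<and> m \<le> d \<and> e = ?e m i"
      proof (cases "m \<le> d")
        case True
        then show ?thesis using m ab ij b by (intro exI[of _ i] exI[of _ m]) auto
      next
        case False
        have "e = ?e (k - m) (i + m)" using ab ij b W_per[of i] by (simp add: vpair_commute)
        then show ?thesis using False m kd by (intro exI[of _ "i + m"] exI[of _ "k - m"]) auto
      qed
      then obtain i m where im: "1 \<le> m" "m \<le> d" "e = ?e m i" by blast
      have "m \<noteq> 1" "m \<noteq> d" using e im in_image by blast+
      then show ?thesis using coefficient_middle[of m i] im by simp
    qed
  qed
  have "c \<bullet> x = (\<Sum>e\<in>UNIV. c $ e * x $ e)" by (simp add: inner_vec_def)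
  also have "\<dots> = (\<Sum>e\<in>?e d ` {0..<k} \<union> ?e 1 ` {0..<k}. c $ e * x $ e)"
    by (rule sum.mono_neutral_right) (auto simp: zero)
  also have "\<dots> = (\<Sum>e\<in>?e d ` {0..<k}. c $ e * x $ e) + (\<Sum>e\<in>?e 1 ` {0..<k}. c $ e * x $ e)"
    by (rule sum.union_disjoint) (use disj in auto)
  also have "(\<Sum>e\<in>?e d ` {0..<k}. c $ e * x $ e) = (\<Sum>i\<in>{0..<k}. - ?\<mu> * x $ ?e d i)"
    using inj[of d] by (simp add: sum.reindex coefficient_chord)
  also have "(\<Sum>e\<in>?e 1 ` {0..<k}. c $ e * x $ e) = (\<Sum>i\<in>{0..<k}. ?\<mu> * x $ ?e 1 i)"
    using inj[of 1] by (simp add: sum.reindex coefficient_edge)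
  finally show ?thesis
    by (simp add: half_chorded_def sum_subtractf sum_distrib_left[symmetric] sum_negf algebra_simps)
qed

text \<open>\<open>c\<close> is a multiple of the half-chorded functional, which takes the value k -
  3 \<noteq> 0 at every tight vertex, while \<open>c\<close> vanishes there. So a single tight
  vertex shows that the factor is 0.\<close>

lemma orthogonal_imp_zero: "c = 0"
proof -
  define h :: "int \<Rightarrow> int" where "h t = (if t < g (0 + d + 1) then 0 else 1)" for t
  have "tight_labelling (g 0) h"
    by (rule tight_labelling_arcs[of _ _ 0 "0 + d + 1" 0 1 2])
      (use kd d in \<open>auto simp: convex_on_window_def h_def g_less_iff\<close>)
  then obtain P where P: "P \<in> decompositions (cycle_edges :: 'n mod_ring set set)"
    "half_chorded k d W (cut_vec P) = k - 3"
    by (rule tight_labelling_cut_vec)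
  then have "c \<bullet> cut_vec P = 0" by (rule orth)
  then have "c $ vpair (W 0) (W 1) = 0"
    using P(2) kd d by (simp add: inner_eq_half_chorded)
  then have "c \<bullet> c = 0" by (simp add: inner_eq_half_chorded)
  then show ?thesis by simp
qed

end

section \<open>True sequences wind, other sequences cross\<close>

lemma to_int_mod_ring_of_int:
  "0 \<le> a \<Longrightarrow> a < int CARD('n) \<Longrightarrow> to_int_mod_ring (of_int a :: 'n::nontriv mod_ring) = a"
  by (simp add: of_int_of_int_mod_ring)

text \<open>The bound on j in the definition keeps j below n, so j is the forward distance from a to
  x.\<close>

lemma mem_cyc_interval_iff:
  fixes a b x :: "'n::nontriv mod_ring"
  shows "x \<in> cyc_interval a b \<longleftrightarrow> to_int_mod_ring (x - a) \<le> to_int_mod_ring (b - a)"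
proof
  assume "x \<in> cyc_interval a b"
  then obtain j where j: "x = a + of_nat j" "int j \<le> to_int_mod_ring (b - a)"
    by (auto simp: cyc_interval_def)
  then have "to_int_mod_ring (of_int (int j) :: 'n mod_ring) = int j"
    using to_int_mod_ring_bounds(2)[of "b - a"] by (intro to_int_mod_ring_of_int) auto
  then show "to_int_mod_ring (x - a) \<le> to_int_mod_ring (b - a)" using j by simp
next
  assume le: "to_int_mod_ring (x - a) \<le> to_int_mod_ring (b - a)"
  define j where "j = nat (to_int_mod_ring (x - a))"
  have j: "int j = to_int_mod_ring (x - a)" using to_int_mod_ring_bounds(1)[of "x - a"] by (simp add: j_def)
  have "of_nat j = (of_int (int j) :: 'n mod_ring)" by simp
  also have "\<dots> = x - a" unfolding j by (rule of_int_to_int_mod_ring)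
  finally have "x = a + of_nat j" by simp
  then show "x \<in> cyc_interval a b" using le j by (auto simp: cyc_interval_def)
qed

section \<open>Lifting a true sequence to the line\<close>

definition periodic_extension :: "nat \<Rightarrow> (nat \<Rightarrow> 'b) \<Rightarrow> int \<Rightarrow> 'b" where
  "periodic_extension k f i = f (nat (i mod int k))"

lemma periodic_extension_add [simp]: "periodic_extension k f (i + int k) = periodic_extension k f i"
  by (simp add: periodic_extension_def)

lemma periodic_extension_int: "periodic_extension k f (int i) = f (i mod k)"
  by (simp add: periodic_extension_def flip: zmod_int)

lemma periodic_extension_eq_iff:
  assumes "inj_on f {..<k}" "0 < k"
  shows "periodic_extension k f i = periodic_extension k f j \<longleftrightarrow> int k dvd i - j"
proof -
  have r: "nat (i mod int k) \<in> {..<k}" for i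
    using assms(2) by (simp add: nat_less_iff)
  have "periodic_extension k f i = periodic_extension k f j \<longleftrightarrow> nat (i mod int k) = nat (j mod int k)"
    unfolding periodic_extension_def using inj_onD[OF assms(1) _ r r] by auto
  also have "\<dots> \<longleftrightarrow> i mod int k = j mod int k" using assms(2) by (simp add: nat_eq_iff)
  finally show ?thesis by (simp add: mod_eq_dvd_iff)
qed

lemma half_chorded_periodic_extension:
  "half_chorded (int k) (int d) (periodic_extension k v) x =
    (\<Sum>i<k. x $ vpair (v i) (v ((i + d) mod k)) - x $ vpair (v i) (v ((i + 1) mod k)))"
  unfolding half_chorded_def
proof (rule sum.reindex_bij_witness[of _ int nat])
  fix i assume "i \<in> {0..<int k}"
  then obtain j where j: "i = int j" "j < k" by (metis atLeastLessThan_iff zero_le_imp_eq_int of_nat_less_iff)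
  then show "x $ vpair (v (nat i)) (v ((nat i + d) mod k)) - x $ vpair (v (nat i)) (v ((nat i + 1) mod k)) =
      x $ vpair (periodic_extension k v i) (periodic_extension k v (i + int d)) -
      x $ vpair (periodic_extension k v i) (periodic_extension k v (i + 1))"
    using periodic_extension_int[of k v j] periodic_extension_int[of k v "j + d"]
      periodic_extension_int[of k v "j + 1"] by (simp add: add.commute)
qed auto

lemma winding_sequence_of_offsets:
  fixes v :: "nat \<Rightarrow> 'n::nontriv mod_ring" and off :: "nat \<Rightarrow> int"
  assumes kd: "k = 2 * d + 1" "2 \<le> d" and \<sigma>: "\<sigma> = 1 \<or> \<sigma> = -1"
    and off: "off 0 = 0" "\<And>i. i < k \<Longrightarrow> off i < int CARD('n)" "\<And>i. i + 1 < k \<Longrightarrow> off i < off (i + 1)"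
    and v: "\<And>i. i < k \<Longrightarrow> v i = v 0 + of_int (\<sigma> * off i)"
  shows "\<exists>g. winding_sequence (int k) (int d) (periodic_extension k v) g \<sigma> (int CARD('n))"
proof -
  define z where "z = to_int_mod_ring (v 0)"
  have z: "of_int z = v 0" unfolding z_def by (rule of_int_to_int_mod_ring)
  have n0: "(of_int (int CARD('n)) :: 'n mod_ring) = 0" by simp
  \<comment> \<open>The factor \<sigma> on \<open>z\<close> cancels when \<open>g\<close> is
    multiplied by \<sigma>; each completed period adds one turn n.\<close>
  define g where "g i = \<sigma> * z + off (nat (i mod int k)) + int CARD('n) * (i div int k)" for i
  have k: "0 < int k" using kd by simp
  have "winding_sequence (int k) (int d) (periodic_extension k v) g \<sigma> (int CARD('n))"
  proof
    fix i
    define r where "r = nat (i mod int k)"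
    have r: "int r = i mod int k" "r < k" using k by (auto simp: r_def nat_less_iff)
    have i: "i + 1 = int r + 1 + i div int k * int k" unfolding r by simp
    show "g i < g (i + 1)"
    proof (cases "r + 1 < k")
      case True
      have "(i + 1) div int k = i div int k" "(i + 1) mod int k = int r + 1"
        unfolding i using True k by auto
      then have "g (i + 1) = \<sigma> * z + off (r + 1) + int CARD('n) * (i div int k)"
        unfolding g_def by (simp add: nat_add_distrib)
      then show ?thesis using off(3)[OF True] by (simp add: g_def flip: r_def)
    next
      case False
      then have "int r + 1 = int k" using r(2) by simp
      then have "(i + 1) div int k = i div int k + 1" "(i + 1) mod int k = 0"
        unfolding i using k by auto
      then have "g (i + 1) = \<sigma> * z + int CARD('n) * (i div int k + 1)"
        unfolding g_def by (simp add: off(1))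
      then show ?thesis using off(2)[OF r(2)] by (simp add: g_def algebra_simps flip: r_def)
    qed
    show "g (i + int k) = g i + int CARD('n)"
      using k by (simp add: g_def algebra_simps)
    have "\<sigma> * g i = z + \<sigma> * off r + \<sigma> * (i div int k) * int CARD('n)"
      using \<sigma> by (auto simp: g_def r_def algebra_simps)
    then have "of_int (\<sigma> * g i) = v 0 + of_int (\<sigma> * off r) + of_int (\<sigma> * (i div int k)) * of_int (int CARD('n))"
      by (simp only: of_int_add of_int_mult z)
    then show "periodic_extension k v i = of_int (\<sigma> * g i)"
      unfolding n0 using v[OF r(2)] by (simp add: periodic_extension_def r_def)
  qed (use kd \<sigma> in auto)
  then show ?thesis by blast
qed

lemma true_to_cycle_imp_winding_sequence:
  fixes v :: "nat \<Rightarrow> 'n::nontriv mod_ring"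
  assumes kd: "k = 2 * d + 1" "2 \<le> d" and true: "true_to_cycle k v"
  shows "\<exists>g \<sigma>. winding_sequence (int k) (int d) (periodic_extension k v) g \<sigma> (int CARD('n))"
proof -
  have idx: "i \<in> {0..k - 2}" if "i + 1 < k" for i using that by auto
  from true[unfolded true_to_cycle_def] show ?thesis
  proof
    assume up: "\<forall>i\<in>{0..k-2}. v i \<in> cyc_interval (v 0) (v (i+1)) - {v (i+1)}"
    define off where "off i = to_int_mod_ring (v i - v 0)" for i
    have v: "v i = v 0 + of_int (1 * off i)" for i by (simp add: off_def of_int_to_int_mod_ring)
    have "off i < off (i + 1)" if "i + 1 < k" for i
    proof -
      have "v i \<in> cyc_interval (v 0) (v (i + 1)) - {v (i + 1)}" using up idx[OF that] by (rule bspec)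
      then have le: "off i \<le> off (i + 1)" and neq: "v i \<noteq> v (i + 1)"
        unfolding off_def mem_cyc_interval_iff[symmetric] by simp_all
      have "off i \<noteq> off (i + 1)"
      proof
        assume "off i = off (i + 1)"
        then have "v 0 + of_int (1 * off i) = v 0 + of_int (1 * off (i + 1))" by (simp only:)
        then show False using neq unfolding v[symmetric] by simp
      qed
      then show ?thesis using le by simp
    qed
    then have "\<exists>g. winding_sequence (int k) (int d) (periodic_extension k v) g 1 (int CARD('n))"
    proof (intro winding_sequence_of_offsets[OF kd])
      show "v i = v 0 + of_int (1 * off i)" for i by (rule v)
    qed (simp_all add: off_def to_int_mod_ring_bounds)
    then show ?thesis by blast
  next
    assume down: "\<forall>i\<in>{0..k-2}. v i \<in> cyc_interval (v (i+1)) (v 0) - {v (i+1)}"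
    define off where "off i = to_int_mod_ring (v 0 - v i)" for i
    have v: "v i = v 0 + of_int (-1 * off i)" for i by (simp add: off_def of_int_to_int_mod_ring)
    have "off i < off (i + 1)" if "i + 1 < k" for i
    proof -
      \<comment> \<open>The interval now starts at \<open>v (i + 1)\<close>, which varies with i.
        Subtracting \<delta> from \<open>off (i + 1)\<close> gives \<open>off i\<close> without
        wrapping, because \<delta> is at most \<open>off (i + 1)\<close>.\<close>
      define \<delta> where "\<delta> = to_int_mod_ring (v i - v (i + 1))"
      have \<delta>: "of_int \<delta> = v i - v (i + 1)" unfolding \<delta>_def by (rule of_int_to_int_mod_ring)
      have "v i \<in> cyc_interval (v (i + 1)) (v 0) - {v (i + 1)}" using down idx[OF that] by (rule bspec)
      then have "\<delta> \<le> off (i + 1)" "v i \<noteq> v (i + 1)"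
        unfolding off_def \<delta>_def mem_cyc_interval_iff[symmetric] by simp_all
      moreover have "\<delta> \<noteq> 0" using \<delta> \<open>v i \<noteq> v (i + 1)\<close> by auto
      moreover have "0 \<le> \<delta>" unfolding \<delta>_def by (rule to_int_mod_ring_bounds)
      moreover have "off (i + 1) < int CARD('n)" unfolding off_def by (rule to_int_mod_ring_bounds)
      moreover have "of_int (off (i + 1) - \<delta>) = v 0 - v i"
        unfolding of_int_diff \<delta> off_def of_int_to_int_mod_ring by simp
      ultimately have "off i = off (i + 1) - \<delta>"
        using to_int_mod_ring_of_int[of "off (i + 1) - \<delta>", where 'n='n] unfolding off_def[of i] by simp
      then show ?thesis using \<open>\<delta> \<noteq> 0\<close> \<open>0 \<le> \<delta>\<close> by simp
    qed
    then have "\<exists>g. winding_sequence (int k) (int d) (periodic_extension k v) g (-1) (int CARD('n))"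
    proof (intro winding_sequence_of_offsets[OF kd])
      show "v i = v 0 + of_int (-1 * off i)" for i by (rule v)
    qed (simp_all add: off_def to_int_mod_ring_bounds)
    then show ?thesis by blast
  qed
qed

section \<open>Closed polygons without crossings\<close>

definition between :: "int \<Rightarrow> int \<Rightarrow> int \<Rightarrow> bool" where
  "between a b t \<longleftrightarrow> a < t \<and> t < b \<or> b < t \<and> t < a"

text \<open>Without crossings, all other points lie on the same side of every edge of the closed polygon.\<close>

lemma noncrossing_monotone:
  fixes f :: "int \<Rightarrow> int"
  assumes k: "3 \<le> k" and per: "f k = 0" and f0: "f 0 = 0"
    and pos: "\<And>i. 0 < i \<Longrightarrow> i < k \<Longrightarrow> 0 < f i"
    and inj: "\<And>i j. 0 < i \<Longrightarrow> i < j \<Longrightarrow> j < k \<Longrightarrow> f i \<noteq> f j"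
    and noncrossing: "\<And>i j. 0 \<le> i \<Longrightarrow> i + 1 < j \<Longrightarrow> j < k \<Longrightarrow> j + 1 < i + k \<Longrightarrow>
      between (f i) (f (i + 1)) (f j) \<longleftrightarrow> between (f i) (f (i + 1)) (f (j + 1))"
  shows "(\<forall>i. 0 < i \<and> i + 1 < k \<longrightarrow> f i < f (i + 1)) \<or> (\<forall>i. 0 < i \<and> i + 1 < k \<longrightarrow> f (i + 1) < f i)"
proof -
  have side: "between (f i) (f (i + 1)) (f s) \<longleftrightarrow> between (f i) (f (i + 1)) (f t)"
    if "0 \<le> i" "i + 2 \<le> s" "s \<le> t" "t \<le> k" "t < i + k" for i s t
  proof (rule ccontr)
    assume no: "\<not> ?thesis"
    obtain r where "s \<le> r" "r < t"
      "between (f i) (f (i + 1)) (f r) \<noteq> between (f i) (f (i + 1)) (f (r + 1))"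
      by (rule cut_between[where B = "\<lambda>r. between (f i) (f (i + 1)) (f r)", OF \<open>s \<le> t\<close> no])
    then show False using noncrossing[of i r] that by auto
  qed
  \<comment> \<open>Index k is the starting point again, with the least value 0, so it is not
    between the two positive ends of edge i. Without crossings, no point from i + 2 on is
    either.\<close>
  have outside: "\<not> between (f i) (f (i + 1)) (f t)" if "0 < i" "i + 2 \<le> t" "t < k" for i t
  proof -
    have "\<not> between (f i) (f (i + 1)) (f k)"
      using pos[of i] pos[of "i + 1"] that per by (auto simp: between_def)
    then show ?thesis using side[of i t k] that by auto
  qed
  \<comment> \<open>The first edge starts at the least value, so being between its ends means being
    below \<open>f 1\<close>. This decides the direction once for all later points.\<close>
  have first: "f t < f 1 \<longleftrightarrow> f 2 < f 1" if "2 \<le> t" "t < k" for t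
    using side[of 0 2 t] pos[of 1] pos[of 2] pos[of t] that f0 by (auto simp: between_def)
  show ?thesis
  proof (cases "f 2 < f 1")
    case True
    have "\<forall>t. i < t \<and> t < k \<longrightarrow> f t < f i" if "1 \<le> i" for i
      using that
    proof (induction i rule: int_ge_induct)
      case base then show ?case using first True by auto
    next
      case (step i)
      show ?case
      proof (intro allI impI)
        fix t assume t: "i + 1 < t \<and> t < k"
        then have "f t < f i" "f t \<noteq> f (i + 1)" using step inj[of "i + 1" t] by auto
        then show "f t < f (i + 1)" using outside[of i t] step.hyps t by (auto simp: between_def)
      qed
    qed
    then show ?thesis by auto
  next
    case False
    have "\<forall>t. i < t \<and> t < k \<longrightarrow> f i < f t" if "1 \<le> i" for i
      using that
    proof (induction i rule: int_ge_induct)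
      case base
      have "f 1 < f t" if "1 < t" "t < k" for t using first[of t] inj[of 1 t] that False by auto
      then show ?case by blast
    next
      case (step i)
      show ?case
      proof (intro allI impI)
        fix t assume t: "i + 1 < t \<and> t < k"
        then have "f i < f t" "f t \<noteq> f (i + 1)" using step inj[of "i + 1" t] by auto
        then show "f (i + 1) < f t" using outside[of i t] step.hyps t by (auto simp: between_def)
      qed
    qed
    then show ?thesis by auto
  qed
qed

text \<open>A block joining a and b contains one of the two arcs between them, and the crossing puts
  s and t on different arcs.\<close>

lemma crossing_same_block:
  fixes P :: "'n::nontriv mod_ring set set"
  assumes P: "P \<in> decompositions cycle_edges"
    and bounds: "a \<in> {0..<int CARD('n)}" "b \<in> {0..<int CARD('n)}" "s \<in> {0..<int CARD('n)}" "t \<in> {0..<int CARD('n)}"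
    and distinct: "s \<noteq> a" "s \<noteq> b" "t \<noteq> a" "t \<noteq> b"
    and crossing: "between a b s \<noteq> between a b t"
    and same: "same_block P (of_int (z + a)) (of_int (z + b))"
  shows "same_block P (of_int (z + a)) (of_int (z + s)) \<or> same_block P (of_int (z + a)) (of_int (z + t))"
proof -
  let ?n = "int CARD('n)"
  have part: "partition_on UNIV P" using P by (simp add: decompositions_def)
  have core: "same_block P (of_int (z + a)) (of_int (z + s)) \<or> same_block P (of_int (z + a)) (of_int (z + t))"
    if "a < s" "s < b" "t < a \<or> b < t" "a \<in> {0..<?n}" "b \<in> {0..<?n}" "t \<in> {0..<?n}"
      "same_block P (of_int (z + a)) (of_int (z + b))" for a b s t
    using that(3)
  proof
    assume "b < t"
    then show ?thesis using that by (intro same_block_arc[OF P that(7)]) auto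
  next
    assume "t < a"
    \<comment> \<open>A position before a in the window lies beyond b one turn later.\<close>
    have "same_block P (of_int (z + a)) (of_int (z + s)) \<or> same_block P (of_int (z + a)) (of_int (z + t + ?n))"
      using \<open>t < a\<close> that by (intro same_block_arc[OF P that(7)]) auto
    moreover have "(of_int (z + t + ?n) :: 'n mod_ring) = of_int (z + t)"
      unfolding of_int_mod_ring_eq_iff by simp
    ultimately show ?thesis by (simp only:)
  qed
  have ordered: "same_block P (of_int (z + a)) (of_int (z + s)) \<or> same_block P (of_int (z + a)) (of_int (z + t))"
    if "a < b" "between a b s \<noteq> between a b t" "s \<noteq> a" "s \<noteq> b" "t \<noteq> a" "t \<noteq> b"
      "a \<in> {0..<?n}" "b \<in> {0..<?n}" "same_block P (of_int (z + a)) (of_int (z + b))" for a b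
  proof (cases "between a b s")
    case True
    then have "a < s" "s < b" "t < a \<or> b < t" using that by (auto simp: between_def)
    then show ?thesis using core[of a s b t] that bounds by blast
  next
    case False
    then have "a < t" "t < b" "s < a \<or> b < s" using that by (auto simp: between_def)
    then show ?thesis using core[of a t b s] that bounds by blast
  qed
  show ?thesis
  proof (cases a b rule: linorder_cases)
    case less
    then show ?thesis using ordered assms by blast
  next
    case equal
    then show ?thesis using crossing by (auto simp: between_def)
  next
    case greater
    have ba: "same_block P (of_int (z + b)) (of_int (z + a))" using same by (rule same_block_sym)
    have "between b a s \<noteq> between b a t" using crossing by (auto simp: between_def)
    then have "same_block P (of_int (z + b)) (of_int (z + s)) \<or> same_block P (of_int (z + b)) (of_int (z + t))"
      using ordered[OF greater] ba bounds distinct by blast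
    then show ?thesis using same_block_trans[OF part same] by blast
  qed
qed

text \<open>One arc and otherwise singletons: with the full window this is the one-block
  decomposition, whose vector is 0; with a short arc it joins just two of the four points of a
  crossing.\<close>

lemma interval_decomposition:
  fixes z p q :: int
  shows "\<exists>P \<in> decompositions (cycle_edges :: 'n::nontriv mod_ring set set).
    \<forall>s\<in>{z..<z + int CARD('n)}. \<forall>t\<in>{z..<z + int CARD('n)}.
      same_block P (of_int s) (of_int t) \<longleftrightarrow> s = t \<or> p \<le> s \<and> s \<le> q \<and> p \<le> t \<and> t \<le> q"
proof -
  define h where "h t = (if p \<le> t \<and> t \<le> q then p else t)" for t
  have "\<exists>P \<in> decompositions (cycle_edges :: 'n mod_ring set set).
    \<forall>s\<in>{z..<z + int CARD('n)}. \<forall>t\<in>{z..<z + int CARD('n)}.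
      same_block P (of_int (1 * s)) (of_int (1 * t)) \<longleftrightarrow> h s = h t"
    by (rule decomposition_of_convex_labelling) (auto simp: h_def split: if_splits)
  moreover have "h s = h t \<longleftrightarrow> s = t \<or> p \<le> s \<and> s \<le> q \<and> p \<le> t \<and> t \<le> q" for s t
    by (auto simp: h_def)
  ultimately show ?thesis by simp
qed

lemma not_true_imp_crossing:
  fixes v :: "nat \<Rightarrow> 'n::nontriv mod_ring"
  assumes k: "3 \<le> k" and inj: "inj_on v {..<k}" and not_true: "\<not> true_to_cycle k v"
  defines "f \<equiv> (\<lambda>i. to_int_mod_ring (periodic_extension k v i - v 0))"
  shows "\<exists>i j. i + 1 < j \<and> j + 1 < i + int k \<and>
    between (f i) (f (i + 1)) (f j) \<noteq> between (f i) (f (i + 1)) (f (j + 1))"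
proof (rule ccontr)
  assume no: "\<not> ?thesis"
  have V: "periodic_extension k v i = v 0 + of_int (f i)" for i
    by (simp add: f_def of_int_to_int_mod_ring)
  have bounds: "0 \<le> f i" "f i < int CARD('n)" for i by (auto simp: f_def to_int_mod_ring_bounds)
  have f0: "f 0 = 0" and fk: "f (int k) = 0" by (simp_all add: f_def periodic_extension_def)
  have f_eq: "f i = f j \<longleftrightarrow> int k dvd i - j" for i j
  proof -
    have "f i = f j \<longleftrightarrow> periodic_extension k v i = periodic_extension k v j"
      using V[of i] V[of j] by (auto simp: f_def)
    then show ?thesis using periodic_extension_eq_iff[OF inj] k by simp
  qed
  have pos: "0 < f i" if "0 < i" "i < int k" for i
    using f_eq[of i 0] f0 bounds(1)[of i] zdvd_not_zless[OF that] by simp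
  have inj_f: "f i \<noteq> f j" if "0 < i" "i < j" "j < int k" for i j
    using f_eq[of j i] zdvd_not_zless[of "j - i" "int k"] that by auto
  have vi: "v i = v 0 + of_int (f (int i))" if "i < k" for i
    using V[of "int i"] periodic_extension_int[of k v i] that by simp
  have "(\<forall>i. 0 < i \<and> i + 1 < int k \<longrightarrow> f i < f (i + 1)) \<or> (\<forall>i. 0 < i \<and> i + 1 < int k \<longrightarrow> f (i + 1) < f i)"
    using k f0 fk pos inj_f no by (intro noncrossing_monotone) auto
  then show False
  proof
    assume up: "\<forall>i. 0 < i \<and> i + 1 < int k \<longrightarrow> f i < f (i + 1)"
    have "v i \<in> cyc_interval (v 0) (v (i + 1)) - {v (i + 1)}" if "i \<in> {0..k-2}" for i
    proof -
      have i: "i < k" "i + 1 < k" using that k by auto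
      have "f (int i) < f (int (i + 1))"
        using up[rule_format, of "int i"] pos[of 1] f0 i by (cases "i = 0") (auto simp: add.commute)
      moreover have "to_int_mod_ring (v i - v 0) = f (int i)" "to_int_mod_ring (v (i + 1) - v 0) = f (int (i + 1))"
        using i periodic_extension_int[of k v i] periodic_extension_int[of k v "i + 1"] by (auto simp: f_def)
      ultimately show ?thesis by (auto simp: mem_cyc_interval_iff)
    qed
    then show False using not_true unfolding true_to_cycle_def by blast
  next
    assume down: "\<forall>i. 0 < i \<and> i + 1 < int k \<longrightarrow> f (i + 1) < f i"
    have "v i \<in> cyc_interval (v (i + 1)) (v 0) - {v (i + 1)}" if "i \<in> {0..k-2}" for i
    proof -
      have i: "i < k" "i + 1 < k" using that k by auto
      have neq: "v i \<noteq> v (i + 1)" using inj_onD[OF inj, of i "i + 1"] i by auto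
      have "to_int_mod_ring (v i - v (i + 1)) \<le> to_int_mod_ring (v 0 - v (i + 1))"
      proof (cases "i = 0")
        case False
        \<comment> \<open>Going forward from \<open>v (i + 1)\<close>, \<open>v i\<close> is reached
          after s - t steps and \<open>v 0\<close> after n - t.\<close>
        define s t where "s = f (int i)" and "t = f (int i + 1)"
        have "t < s" using down False i by (auto simp: s_def t_def)
        have "0 < t" using pos[of "int i + 1"] i by (simp add: t_def)
        have "s < int CARD('n)" using bounds(2) by (simp add: s_def)
        have st: "v i = v 0 + of_int s" "v (i + 1) = v 0 + of_int t"
          using vi[OF i(1)] vi[OF i(2)] by (simp_all add: s_def t_def add.commute)
        have "v i - v (i + 1) = of_int (s - t)" unfolding st by simp
        moreover have "v 0 - v (i + 1) = of_int (int CARD('n) - t)" unfolding st by simp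
        ultimately show ?thesis
          using to_int_mod_ring_of_int[of "s - t", where 'n='n]
            to_int_mod_ring_of_int[of "int CARD('n) - t", where 'n='n]
            \<open>t < s\<close> \<open>0 < t\<close> \<open>s < int CARD('n)\<close> by simp
      qed simp
      then show ?thesis using neq by (simp add: mem_cyc_interval_iff)
    qed
    then show False using not_true unfolding true_to_cycle_def by blast
  qed
qed

section \<open>The equation attached to a crossing\<close>

lemma LMC_eq: "LMC E = convex hull (cut_vec ` decompositions E)"
  by (simp add: LMC_def cut_vec_def)

lemma zero_in_cut_vecs: "0 \<in> cut_vec ` decompositions (cycle_edges :: 'n::nontriv mod_ring set set)"
proof -
  obtain P where P: "P \<in> decompositions (cycle_edges :: 'n mod_ring set set)"
    and same: "\<And>s t. s \<in> {0..<int CARD('n)} \<Longrightarrow> t \<in> {0..<int CARD('n)} \<Longrightarrow> same_block P (of_int s) (of_int t)"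
    using interval_decomposition[of 0 0 "int CARD('n)", where 'n='n] by fastforce
  have "same_block P a b" for a b
    using same[of "to_int_mod_ring a" "to_int_mod_ring b"]
    by (simp add: to_int_mod_ring_bounds of_int_to_int_mod_ring)
  moreover have "partition_on UNIV P" using P by (simp add: decompositions_def)
  ultimately have "cut_vec P $ e = 0" for e
    by (cases e rule: vpair_cases) (simp add: cut_vec_def char_vec_lifted_multicut)
  then have "cut_vec P = 0" by (simp add: vec_eq_iff)
  then show ?thesis using P by (metis imageI)
qed

lemma between_crossing_commute:
  assumes "a \<noteq> b" "a \<noteq> s" "a \<noteq> t" "b \<noteq> s" "b \<noteq> t" "s \<noteq> t" "between a b s \<noteq> between a b t"
  shows "between s t a \<noteq> between s t b"
  using assms unfolding between_def by (smt (verit))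

text \<open>On the circle a is next to s and b is next to t. Opening the circle to a line can
  separate at most one of these neighbouring pairs.\<close>

lemma between_crossing_adjacent:
  assumes "a \<noteq> b" "a \<noteq> s" "a \<noteq> t" "b \<noteq> s" "b \<noteq> t" "s \<noteq> t" "between a b s \<noteq> between a b t"
  shows "\<not> between a s b \<and> \<not> between a s t \<or> \<not> between b t a \<and> \<not> between b t s"
  using assms unfolding between_def by (smt (verit))

lemma half_chorded_cut_vec_le:
  assumes kd: "k = 2 * d + 1" "1 \<le> d" and per: "\<And>i. W (i + k) = W i"
    and W: "\<And>i. W i \<noteq> W (i + d)" "\<And>i. W i \<noteq> W (i + 1)" and P: "partition_on UNIV P"
  shows "half_chorded k d W (cut_vec P) \<le> k - 3"
  unfolding half_chorded_cut_vec[where W = W and d = d, OF P W]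
  by (rule half_chorded_valid[of "block_of P \<circ> W" k d]) (use kd per in auto)

text \<open>Tightness forces one of the four joins in \<open>cuts\<close>. A joined edge i, i + 1 or
  j, j + 1 captures an end of the other edge; three of the points then share a block, and both sides
  equal the coordinate that tells whether the fourth is separated from it. If neither edge is
  joined, the join of i + 1 with j or of j + 1 with i forces i, j and i + 1, j + 1 apart, so both
  sides are 2.\<close>

lemma half_chorded_tight_crossing:
  fixes W :: "int \<Rightarrow> 'n::nontriv mod_ring" and f :: "int \<Rightarrow> int"
  assumes k: "0 < k" and per: "\<And>i. W (i + k) = W i"
    and W_neq: "\<And>i. W i \<noteq> W (i + d)" "\<And>i. W i \<noteq> W (i + 1)"
    and f: "\<And>i. W i = of_int (z + f i)" "\<And>i. f i \<in> {0..<int CARD('n)}"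
    and ij: "i + 1 < j" "j + 1 < i + k"
    and distinct: "f i \<noteq> f (i + 1)" "f i \<noteq> f j" "f i \<noteq> f (j + 1)" "f (i + 1) \<noteq> f j"
      "f (i + 1) \<noteq> f (j + 1)" "f j \<noteq> f (j + 1)"
    and crossing: "between (f i) (f (i + 1)) (f j) \<noteq> between (f i) (f (i + 1)) (f (j + 1))"
    and P: "P \<in> decompositions cycle_edges" and tight: "half_chorded k d W (cut_vec P) = k - 3"
  shows "cut_vec P $ vpair (W i) (W (i + 1)) + cut_vec P $ vpair (W j) (W (j + 1)) =
    cut_vec P $ vpair (W i) (W j) + cut_vec P $ vpair (W (i + 1)) (W (j + 1))"
proof -
  have part: "partition_on UNIV P" using P by (simp add: decompositions_def)
  define B where "B = block_of P \<circ> W"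
  have B: "B s = B t \<longleftrightarrow> same_block P (W s) (W t)" for s t
    by (simp add: B_def block_of_eq_iff[OF part])
  have cuts: "B i = B (i + 1) \<or> B j = B (j + 1) \<or> B (i + 1) = B j \<or> B (j + 1) = B i"
  proof (rule half_chorded_tight_cuts[of B k d])
    show "(\<Sum>i = 0..<k. cut B i (i + d) - cut B i (i + 1)) = k - 3"
      using tight unfolding half_chorded_cut_vec[where W = W and d = d, OF part W_neq] B_def .
  qed (use k per ij in \<open>auto simp: B_def\<close>)
  have arc1: "B i = B j \<or> B i = B (j + 1)" if "B i = B (i + 1)"
    using crossing_same_block[OF P f(2) f(2) f(2) f(2), of j i "i + 1" "j + 1" z] distinct crossing that
    unfolding B f(1) by auto
  have "between (f j) (f (j + 1)) (f i) \<noteq> between (f j) (f (j + 1)) (f (i + 1))"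
    using between_crossing_commute[OF distinct crossing] .
  then have arc2: "B j = B i \<or> B j = B (i + 1)" if "B j = B (j + 1)"
    using crossing_same_block[OF P f(2) f(2) f(2) f(2), of i j "j + 1" "i + 1" z] distinct that
    unfolding B f(1) by auto
  have neq: "W s \<noteq> W t" if "f s \<noteq> f t" for s t
  proof
    assume "W s = W t"
    then have "int CARD('n) dvd f s - f t" unfolding f(1) of_int_mod_ring_eq_iff by simp
    moreover have "\<bar>f s - f t\<bar> < int CARD('n)" using f(2)[of s] f(2)[of t] by auto
    ultimately show False using that dvd_imp_le_int[of "f s - f t" "int CARD('n)"] by auto
  qed
  have val: "cut_vec P $ vpair (W s) (W t) = (if B s = B t then 0 else 1)" if "f s \<noteq> f t" for s t
    unfolding cut_vec_def char_vec_lifted_multicut[OF part neq[OF that]] B ..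
  show ?thesis unfolding val[OF distinct(1)] val[OF distinct(2)] val[OF distinct(5)] val[OF distinct(6)]
    using cuts arc1 arc2 by (smt (verit))
qed

text \<open>Join i and j only, or i' and j' only, whichever pair is adjacent on the line: then the
  left side is 2 and the right side 1.\<close>

lemma crossing_violation:
  fixes W :: "int \<Rightarrow> 'n::nontriv mod_ring" and f :: "int \<Rightarrow> int"
  assumes f: "\<And>i. W i = of_int (z + f i)" "\<And>i. f i \<in> {0..<int CARD('n)}"
    and distinct: "f i \<noteq> f i'" "f i \<noteq> f j" "f i \<noteq> f j'" "f i' \<noteq> f j" "f i' \<noteq> f j'" "f j \<noteq> f j'"
    and crossing: "between (f i) (f i') (f j) \<noteq> between (f i) (f i') (f j')"
  shows "\<exists>P \<in> decompositions cycle_edges.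
    cut_vec P $ vpair (W i) (W i') + cut_vec P $ vpair (W j) (W j') \<noteq>
    cut_vec P $ vpair (W i) (W j) + cut_vec P $ vpair (W i') (W j')"
proof -
  have sep: "\<exists>P \<in> decompositions (cycle_edges :: 'n mod_ring set set). \<forall>s t. f s \<noteq> f t \<longrightarrow>
      cut_vec P $ vpair (W s) (W t) = (if p \<le> f s \<and> f s \<le> q \<and> p \<le> f t \<and> f t \<le> q then 0 else 1)" for p q
  proof -
    obtain P where P: "P \<in> decompositions (cycle_edges :: 'n mod_ring set set)"
      and same: "\<And>s t. s \<in> {z..<z + int CARD('n)} \<Longrightarrow> t \<in> {z..<z + int CARD('n)} \<Longrightarrow>
        same_block P (of_int s) (of_int t) \<longleftrightarrow> s = t \<or> z + p \<le> s \<and> s \<le> z + q \<and> z + p \<le> t \<and> t \<le> z + q"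
      using interval_decomposition[of z "z + p" "z + q", where 'n='n] by blast
    have part: "partition_on UNIV P" using P by (simp add: decompositions_def)
    have "cut_vec P $ vpair (W s) (W t) = (if p \<le> f s \<and> f s \<le> q \<and> p \<le> f t \<and> f t \<le> q then 0 else 1)"
      if "f s \<noteq> f t" for s t
    proof -
      have "W s \<noteq> W t"
      proof
        assume "W s = W t"
        then have "int CARD('n) dvd f s - f t" unfolding f(1) of_int_mod_ring_eq_iff by simp
        moreover have "\<bar>f s - f t\<bar> < int CARD('n)" using f(2)[of s] f(2)[of t] by auto
        ultimately show False using that dvd_imp_le_int[of "f s - f t" "int CARD('n)"] by auto
      qed
      moreover have "same_block P (W s) (W t) \<longleftrightarrow> p \<le> f s \<and> f s \<le> q \<and> p \<le> f t \<and> f t \<le> q"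
        unfolding f(1) using same[of "z + f s" "z + f t"] f(2)[of s] f(2)[of t] that by auto
      ultimately show ?thesis by (simp add: cut_vec_def char_vec_lifted_multicut[OF part])
    qed
    then show ?thesis using P by blast
  qed
  have "\<not> between (f i) (f j) (f i') \<and> \<not> between (f i) (f j) (f j') \<or>
      \<not> between (f i') (f j') (f i) \<and> \<not> between (f i') (f j') (f j)"
    using between_crossing_adjacent[OF distinct crossing] .
  then show ?thesis
  proof
    assume *: "\<not> between (f i) (f j) (f i') \<and> \<not> between (f i) (f j) (f j')"
    obtain P where P: "P \<in> decompositions (cycle_edges :: 'n mod_ring set set)" and val: "\<forall>s t. f s \<noteq> f t \<longrightarrow>
      cut_vec P $ vpair (W s) (W t) = (if min (f i) (f j) \<le> f s \<and> f s \<le> max (f i) (f j) \<and>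
        min (f i) (f j) \<le> f t \<and> f t \<le> max (f i) (f j) then 0 else 1)"
      using sep[of "min (f i) (f j)" "max (f i) (f j)"] by (rule bexE)
    have "\<not> (min (f i) (f j) \<le> f r \<and> f r \<le> max (f i) (f j))"
      if "\<not> between (f i) (f j) (f r)" "f r \<noteq> f i" "f r \<noteq> f j" for r
      using that unfolding between_def min_def max_def by (smt (verit))
    then have "\<not> (min (f i) (f j) \<le> f i' \<and> f i' \<le> max (f i) (f j))"
      "\<not> (min (f i) (f j) \<le> f j' \<and> f j' \<le> max (f i) (f j))"
      using * distinct by metis+
    then show ?thesis
      by (intro bexI[OF _ P]) (simp add: val[rule_format] distinct)
  next
    assume *: "\<not> between (f i') (f j') (f i) \<and> \<not> between (f i') (f j') (f j)"
    obtain P where P: "P \<in> decompositions (cycle_edges :: 'n mod_ring set set)" and val: "\<forall>s t. f s \<noteq> f t \<longrightarrow>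
      cut_vec P $ vpair (W s) (W t) = (if min (f i') (f j') \<le> f s \<and> f s \<le> max (f i') (f j') \<and>
        min (f i') (f j') \<le> f t \<and> f t \<le> max (f i') (f j') then 0 else 1)"
      using sep[of "min (f i') (f j')" "max (f i') (f j')"] by (rule bexE)
    have "\<not> (min (f i') (f j') \<le> f r \<and> f r \<le> max (f i') (f j'))"
      if "\<not> between (f i') (f j') (f r)" "f r \<noteq> f i'" "f r \<noteq> f j'" for r
      using that unfolding between_def min_def max_def by (smt (verit))
    then have "\<not> (min (f i') (f j') \<le> f i \<and> f i \<le> max (f i') (f j'))"
      "\<not> (min (f i') (f j') \<le> f j \<and> f j \<le> max (f i') (f j'))"
      using * distinct by metis+
    then show ?thesis
      by (intro bexI[OF _ P]) (simp add: val[rule_format] distinct)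
  qed
qed

theorem theorem7p22:
  fixes k d :: nat and v :: "nat \<Rightarrow> 'n::nontriv mod_ring"
  assumes "5 \<le> k" and "k \<le> CARD('n)" and "odd k"
    and "d = (k - 1) div 2"
    and "inj_on v {..<k}"
  shows "facet_defining
      (\<lambda>x :: real ^ 'n vpair.
        \<Sum>i<k. x $ vpair (v i) (v ((i + d) mod k)) - x $ vpair (v i) (v ((i + 1) mod k)))
      (real k - 3)
      (LMC (cycle_edges :: 'n mod_ring set set))
    \<longleftrightarrow> true_to_cycle k v"
proof -
  let ?X = "cut_vec ` decompositions (cycle_edges :: 'n mod_ring set set)"
  define V where "V = periodic_extension k v"
  define F where "F = half_chorded (int k) (int d) V"
  have kd: "k = 2 * d + 1" "2 \<le> d" using assms(1,3,4) by presburger+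
  have rk: "real k - 3 = real_of_int (int k - 3)" by simp
  have lin: "linear F" unfolding F_def by (rule linear_half_chorded)
  have b: "real k - 3 \<noteq> 0" using assms(1) by simp
  have V_per: "V (i + int k) = V i" for i by (simp add: V_def)
  have V_eq: "V i = V j \<longleftrightarrow> int k dvd i - j" for i j
    unfolding V_def by (rule periodic_extension_eq_iff) (use assms in auto)
  have not_dvd: "\<not> int k dvd m" if "0 < m" "m < int k" for m using that by (rule zdvd_not_zless)
  have V_neq: "V i \<noteq> V (i + int d)" "V i \<noteq> V (i + 1)" for i
    using not_dvd[of "int d"] not_dvd[of 1] kd by (auto simp: V_eq)
  have valid: "F x \<le> real k - 3" if x: "x \<in> ?X" for x
  proof -
    obtain P where P: "P \<in> decompositions (cycle_edges :: 'n mod_ring set set)" "x = cut_vec P"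
      using x by (rule imageE) simp
    then have "partition_on UNIV P" by (simp add: decompositions_def)
    then show ?thesis
      unfolding F_def P rk using kd V_per V_neq by (intro half_chorded_cut_vec_le) simp_all
  qed
  have "facet_defining F (real k - 3) (convex hull ?X) \<longleftrightarrow> true_to_cycle k v"
  proof
    assume "true_to_cycle k v"
    from true_to_cycle_imp_winding_sequence[OF kd this]
    obtain g \<sigma> where wind: "winding_sequence (int k) (int d) V g \<sigma> (int CARD('n))"
      unfolding V_def by blast
    show "facet_defining F (real k - 3) (convex hull ?X)"
    proof (rule facet_of_convex_hullI[OF zero_in_cut_vecs lin b valid])
      fix c :: "real ^ 'n vpair"
      assume c: "\<And>x. x \<in> ?X \<Longrightarrow> F x = real k - 3 \<Longrightarrow> c \<bullet> x = 0"
      have "c \<bullet> cut_vec P = 0"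
        if "P \<in> decompositions (cycle_edges :: 'n mod_ring set set)"
          "half_chorded (int k) (int d) V (cut_vec P) = int k - 3" for P
        by (rule c[OF imageI[OF that(1)]]) (simp add: F_def that(2))
      with wind have "orthogonal_to_tight (int k) (int d) V g \<sigma> (int CARD('n)) c"
        by (intro orthogonal_to_tight.intro orthogonal_to_tight_axioms.intro)
      then show "c = 0" by (rule orthogonal_to_tight.orthogonal_imp_zero)
    qed
  next
    assume facet: "facet_defining F (real k - 3) (convex hull ?X)"
    show "true_to_cycle k v"
    proof (rule ccontr)
      assume not_true: "\<not> true_to_cycle k v"
      define f where "f i = to_int_mod_ring (V i - v 0)" for i
      define z where "z = to_int_mod_ring (v 0)"
      obtain i j where ij: "i + 1 < j" "j + 1 < i + int k"
        and cross: "between (f i) (f (i + 1)) (f j) \<noteq> between (f i) (f (i + 1)) (f (j + 1))"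
        using not_true_imp_crossing[OF _ assms(5) not_true] assms(1) unfolding f_def V_def by auto
      have f: "V s = of_int (z + f s)" "f s \<in> {0..<int CARD('n)}" for s
        by (simp_all add: z_def f_def of_int_to_int_mod_ring to_int_mod_ring_bounds)
      have f_neq: "f s \<noteq> f t" if "s < t" "t < s + int k" for s t
      proof
        assume "f s = f t"
        then have "V t = V s" by (simp add: f(1))
        then show False using not_dvd[of "t - s"] that by (simp add: V_eq)
      qed
      have distinct: "f i \<noteq> f (i + 1)" "f i \<noteq> f j" "f i \<noteq> f (j + 1)" "f (i + 1) \<noteq> f j"
        "f (i + 1) \<noteq> f (j + 1)" "f j \<noteq> f (j + 1)"
        using ij f_neq[of i "i + 1"] f_neq[of i j] f_neq[of i "j + 1"] f_neq[of "i + 1" j]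
          f_neq[of "i + 1" "j + 1"] f_neq[of j "j + 1"] by simp_all
      \<comment> \<open>The crossing equation as a functional without constant term, so that it
        vanishes at the origin and extends from the face to the whole polytope.\<close>
      define G :: "real ^ 'n vpair \<Rightarrow> real" where "G x = x $ vpair (V i) (V (i + 1)) + x $ vpair (V j) (V (j + 1))
        - x $ vpair (V i) (V j) - x $ vpair (V (i + 1)) (V (j + 1))" for x
      have linG: "linear G" by (rule linearI) (simp_all add: G_def algebra_simps)
      have tight: "G x = 0" if x: "x \<in> ?X" and Fx: "F x = real k - 3" for x
      proof -
        obtain P where P: "P \<in> decompositions (cycle_edges :: 'n mod_ring set set)" "x = cut_vec P"
          using x by (rule imageE) simp
        have "half_chorded (int k) (int d) V (cut_vec P) = int k - 3" using Fx P by (simp add: F_def)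
        from half_chorded_tight_crossing[OF _ V_per V_neq f ij distinct cross P(1) this]
        show ?thesis using kd by (simp add: G_def P(2))
      qed
      from crossing_violation[OF f distinct cross]
      obtain P where P: "P \<in> decompositions (cycle_edges :: 'n mod_ring set set)" and
        "cut_vec P $ vpair (V i) (V (i + 1)) + cut_vec P $ vpair (V j) (V (j + 1)) \<noteq>
        cut_vec P $ vpair (V i) (V j) + cut_vec P $ vpair (V (i + 1)) (V (j + 1))" by (rule bexE)
      then have "G (cut_vec P) \<noteq> 0" by (simp add: G_def)
      have face: "{x \<in> convex hull ?X. F x = real k - 3} facet_of convex hull ?X"
        using facet by (simp add: facet_defining_def)
      have "G (cut_vec P) = 0"
      proof (rule facet_of_convex_hull_equation_extends[where X = ?X and f = F and g = G and b = "real k - 3",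
            OF _ zero_in_cut_vecs lin linG b face])
        show "finite ?X" by (rule finite_imageI) (rule finite)
        show "G x = 0" if "x \<in> ?X" "F x = real k - 3" for x using that by (rule tight)
        show "cut_vec P \<in> ?X" using P by (rule imageI)
      qed
      with \<open>G (cut_vec P) \<noteq> 0\<close> show False by simp
    qed
  qed
  then show ?thesis
    unfolding LMC_eq F_def V_def half_chorded_periodic_extension .
qed

end
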